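(* Let $X_1,\dots,X_n$ be i.i.d. categorical with $k$ categories and probability vector $p$, and consider testing $H_0:p=p_0$ versus $H_1:p\ne p_0$ by rejecting for large values of the Pearson statistic $$\chi_n^2=\sum_{j=1}^k\frac{(N_j-np_{0j})^2}{np_{0j}}.$$ Suppose the prior $\Pi_1$ on the alternative is a Dirichlet prior whose density is positive and continuous near $p_0$, so that $\Pi_1(\|p-p_0\|_2\le\varepsilon)\asymp\varepsilon^{k-1}$ for small $\varepsilon$. Then the Bayes-risk optimal critical value satisfies $$\chi_n^{2*}=(k-1)\log n+O(\log\log n),$$ equivalently $\alpha_n^*\asymp n^{-(k-1)/2}$ up to polylogarithmic factors.
   Context: $N_j=\#\{i\le n: X_i=j\}$ is the count of category $j$, and $p_0=(p_{01},\dots,p_{0k})$ is a fixed probability vector with positive entries. The Bayes risk of the test rejecting when $\chi_n^2>c$ is $$\pi_0L_0\,\mathbb{P}_{p_0}(\chi_n^2>c)+\pi_1L_1\int\mathbb{P}_p(\chi_n^2\le c)\,\Pi_1(dp),$$ where $\pi_0,\pi_1>0$ with $\pi_0+\pi_1=1$ are the prior probabilities of the hypotheses and $L_0,L_1>0$ are the Type I and Type II losses. The Bayes-risk optimal critical value $\chi_n^{2*}$ is the minimiser in $c$ of this Bayes risk, and $\alpha_n^*=\mathbb{P}_{p_0}(\chi_n^2>\chi_n^{2*})$. The notation $f\asymp g$ means $c\,g\le f\le C\,g$ for positive constants $c,C$ independent of $n$. *)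

theory Defs
  imports "HOL-Probability.Probability" "HOL-Library.Landau_Symbols"
begin

text \<open>Categories are \<open>1, \<dots>, k\<close>. A vector indexed by the categories is a function
  \<open>nat \<Rightarrow> real\<close> of which only the values on \<open>{1..k}\<close> matter.\<close>

definition prob_simplex :: "nat \<Rightarrow> (nat \<Rightarrow> real) set" where
  "prob_simplex k = {p. (\<forall>j\<in>{1..k}. 0 \<le> p j) \<and> (\<Sum>j\<in>{1..k}. p j) = 1}"

text \<open>Off the simplex \<open>embed_pmf\<close> is unspecified; the default value there only serves to
  keep functions such as \<open>p \<mapsto> P\<^sub>p(A)\<close> Borel measurable on the whole space carrying
  the prior, so that the Bochner integral in \<open>bayes_risk\<close> is the intended one.\<close>

definition categorical_pmf :: "nat \<Rightarrow> (nat \<Rightarrow> real) \<Rightarrow> nat pmf" where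
  "categorical_pmf k p =
     (if p \<in> prob_simplex k then embed_pmf (\<lambda>j. if j \<in> {1..k} then p j else 0)
      else return_pmf 1)"

text \<open>The joint law \<open>P\<^sub>p\<close> of an i.i.d. sample \<open>X 1, \<dots>, X n\<close>; a sample is a function
  with value \<open>0\<close> outside \<open>{1..n}\<close>.\<close>

definition iid_sample :: "nat \<Rightarrow> nat \<Rightarrow> (nat \<Rightarrow> real) \<Rightarrow> (nat \<Rightarrow> nat) pmf" where
  "iid_sample k n p = Pi_pmf {1..n} 0 (\<lambda>_. categorical_pmf k p)"

definition category_count :: "nat \<Rightarrow> (nat \<Rightarrow> nat) \<Rightarrow> nat \<Rightarrow> nat" where
  "category_count n X j = card {i \<in> {1..n}. X i = j}"

definition pearson :: "nat \<Rightarrow> nat \<Rightarrow> (nat \<Rightarrow> real) \<Rightarrow> (nat \<Rightarrow> nat) \<Rightarrow> real" where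
  "pearson k n p0 X =
     (\<Sum>j\<in>{1..k}. (real (category_count n X j) - real n * p0 j)\<^sup>2 / (real n * p0 j))"

text \<open>The Dirichlet density is taken with respect to Lebesgue measure in the first
  \<open>k - 1\<close> coordinates of the simplex. It is set to \<open>0\<close> off the open simplex, which
  changes it on a null set only.\<close>

definition dirichlet_density :: "nat \<Rightarrow> (nat \<Rightarrow> real) \<Rightarrow> (nat \<Rightarrow> real) \<Rightarrow> real" where
  "dirichlet_density k a p =
     (if p \<in> prob_simplex k \<and> (\<forall>j\<in>{1..k}. 0 < p j)
      then Gamma (\<Sum>j\<in>{1..k}. a j) / (\<Prod>j\<in>{1..k}. Gamma (a j)) *
           (\<Prod>j\<in>{1..k}. p j powr (a j - 1))
      else 0)"

definition simplex_point :: "nat \<Rightarrow> (nat \<Rightarrow> real) \<Rightarrow> (nat \<Rightarrow> real)" where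
  "simplex_point k y = (\<lambda>j\<in>{1..k}. if j < k then y j else 1 - (\<Sum>i\<in>{1..<k}. y i))"

definition dirichlet :: "nat \<Rightarrow> (nat \<Rightarrow> real) \<Rightarrow> (nat \<Rightarrow> real) measure" where
  "dirichlet k a =
     distr (density (PiM {1..<k} (\<lambda>_. lborel))
              (\<lambda>y. ennreal (dirichlet_density k a (simplex_point k y))))
       (PiM {1..k} (\<lambda>_. borel)) (simplex_point k)"

definition near_simplex :: "nat \<Rightarrow> (nat \<Rightarrow> real) \<Rightarrow> real \<Rightarrow> (nat \<Rightarrow> real) set" where
  "near_simplex k p0 \<epsilon> =
     {p \<in> prob_simplex k. L2_set (\<lambda>j. p j - p0 j) {1..k} \<le> \<epsilon>}"

definition type1_prob :: "nat \<Rightarrow> nat \<Rightarrow> (nat \<Rightarrow> real) \<Rightarrow> real \<Rightarrow> real" where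
  "type1_prob k n p0 c = measure_pmf.prob (iid_sample k n p0) {X. pearson k n p0 X > c}"

definition type2_prob ::
    "nat \<Rightarrow> nat \<Rightarrow> (nat \<Rightarrow> real) \<Rightarrow> (nat \<Rightarrow> real) \<Rightarrow> real \<Rightarrow> real" where
  "type2_prob k n p0 p c = measure_pmf.prob (iid_sample k n p) {X. pearson k n p0 X \<le> c}"

definition bayes_risk ::
    "nat \<Rightarrow> (nat \<Rightarrow> real) \<Rightarrow> (nat \<Rightarrow> real) measure \<Rightarrow>
     real \<Rightarrow> real \<Rightarrow> real \<Rightarrow> real \<Rightarrow> nat \<Rightarrow> real \<Rightarrow> real" where
  "bayes_risk k p0 prior \<pi>0 \<pi>1 L0 L1 n c =
     \<pi>0 * L0 * type1_prob k n p0 c + \<pi>1 * L1 * (\<integral>p. type2_prob k n p0 p c \<partial>prior)"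

text \<open>The statistic is discrete, so the Bayes risk is a step function of \<open>c\<close> and its
  minimiser is not unique; the predicate holds of every minimiser.\<close>

definition bayes_optimal ::
    "nat \<Rightarrow> (nat \<Rightarrow> real) \<Rightarrow> (nat \<Rightarrow> real) measure \<Rightarrow>
     real \<Rightarrow> real \<Rightarrow> real \<Rightarrow> real \<Rightarrow> nat \<Rightarrow> real \<Rightarrow> bool" where
  "bayes_optimal k p0 prior \<pi>0 \<pi>1 L0 L1 n c \<longleftrightarrow>
     is_arg_min (bayes_risk k p0 prior \<pi>0 \<pi>1 L0 L1 n) (\<lambda>_. True) c"

definition asymp_up_to_polylog :: "(nat \<Rightarrow> real) \<Rightarrow> (nat \<Rightarrow> real) \<Rightarrow> bool" where
  "asymp_up_to_polylog f g \<longleftrightarrow>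
     (\<exists>A c C. 0 < c \<and> 0 < C \<and>
        (\<forall>\<^sub>F n in at_top. c * ln (real n) powr (- A) * g n \<le> f n \<and>
                         f n \<le> C * ln (real n) powr A * g n))"

lemma finite_range_pearson: "finite (range (pearson k n p0))"
proof -
  let ?N = "\<lambda>X. restrict (category_count n X) {1..k}"
  have "pearson k n p0 X \<in>
      (\<lambda>N. \<Sum>j\<in>{1..k}. (real (N j) - real n * p0 j)\<^sup>2 / (real n * p0 j)) `
        (PiE {1..k} (\<lambda>_. {..n}))" for X
  proof (rule image_eqI[of _ _ "?N X"])
    show "pearson k n p0 X =
        (\<Sum>j\<in>{1..k}. (real (?N X j) - real n * p0 j)\<^sup>2 / (real n * p0 j))"
      unfolding pearson_def by (intro sum.cong) auto
    have "category_count n X j \<le> n" for j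
      unfolding category_count_def
      using card_mono[of "{1..n}" "{i \<in> {1..n}. X i = j}"]
      by (metis (no_types, lifting) card_atLeastAtMost diff_Suc_1 finite_atLeastAtMost
          mem_Collect_eq subsetI)
    then show "?N X \<in> PiE {1..k} (\<lambda>_. {..n})"
      by auto
  qed
  then have "range (pearson k n p0) \<subseteq>
      (\<lambda>N. \<Sum>j\<in>{1..k}. (real (N j) - real n * p0 j)\<^sup>2 / (real n * p0 j)) `
        (PiE {1..k} (\<lambda>_. {..n}))"
    by blast
  then show ?thesis
    by (rule finite_subset) (intro finite_imageI finite_PiE, auto)
qed

lemma bayes_optimal_exists: "\<exists>c. bayes_optimal k p0 prior \<pi>0 \<pi>1 L0 L1 n c"
proof -
  let ?R = "bayes_risk k p0 prior \<pi>0 \<pi>1 L0 L1 n"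
  define V where "V = range (pearson k n p0)"
  define G where "G = (\<lambda>B. \<pi>0 * L0 * measure_pmf.prob (iid_sample k n p0)
        {X. pearson k n p0 X \<notin> B} +
      \<pi>1 * L1 * (\<integral>p. measure_pmf.prob (iid_sample k n p) {X. pearson k n p0 X \<in> B} \<partial>prior))"
  have fin: "finite (G ` Pow V)"
    using finite_range_pearson by (simp add: V_def)
  have eq: "?R c = G {v \<in> V. v \<le> c}" for c
    by (simp add: bayes_risk_def type1_prob_def type2_prob_def G_def V_def not_le)
  have "range ?R \<subseteq> G ` Pow V"
    using eq by auto
  then have finR: "finite (range ?R)"
    using fin finite_subset by blast
  then have "Min (range ?R) \<in> range ?R"
    by (intro Min_in) auto
  then obtain c where c: "?R c = Min (range ?R)"
    by (metis rangeE)
  have "?R c \<le> ?R c'" for c'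
    unfolding c using finR by (intro Min_le) auto
  then show ?thesis
    unfolding bayes_optimal_def is_arg_min_def by (metis not_le)
qed

end

theory Submission
  imports Defs "HOL-Combinatorics.Multiset_Permutations" "HOL-Real_Asymp.Real_Asymp"
begin

text \<open>
  Put \<open>d = k - 1\<close>. Uniformly in the levels \<open>0 \<le> x \<le> B ln n\<close>, three estimates hold up to constants.
  The Type I error at level \<open>x\<close> lies between \<open>(ln n) powr (- d / 2) * exp (- x / 2)\<close> and
  \<open>(ln n) powr (d / 2) * exp (- x / 2)\<close> (lemmas \<open>type1_prob_lower\<close> and \<open>type1_prob_upper\<close>). The prior
  average of the Type II error is at most \<open>(ln n / n) powr (d / 2)\<close> (lemma \<open>average_type2_upper\<close>). When the
  level rises from \<open>x\<close> to \<open>x + 1\<close>, this average grows by at least \<open>(n ln n) powr (- d / 2)\<close> (lemma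
  \<open>average_type2_shell\<close>).

  The theorem follows by comparing the optimal level with \<open>c = d ln n + (2 d + 1) ln (ln n)\<close>. There the
  Type I error is at most \<open>(ln n) powr (- (d + 1) / 2) * n powr (- d / 2)\<close>, which is eventually less than
  the growth of the average Type II error from \<open>c\<close> to \<open>c + 1\<close>; hence no level from \<open>c + 1\<close> on can be
  optimal. The risk at \<open>c\<close> is at most \<open>(ln n / n) powr (d / 2)\<close>, whereas at the level
  \<open>d ln n - (2 d + 1) ln (ln n)\<close> the Type I error alone is at least
  \<open>(ln n) powr ((d + 1) / 2) * n powr (- d / 2)\<close>; hence no level up to this one can be optimal either. The
  bounds for the Type I error at the optimal level come from the same two comparisons.

  The probabilities in question are polynomially small in \<open>n\<close>, beyond the reach of limit theorems, so
  they are estimated one lattice point at a time. Stirling's bounds give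
  each vector of counts the probability \<open>n powr (- d / 2)\<close> times the exponential of minus its relative
  entropy, and for counts with \<open>chi_square = O(ln n)\<close> the entropy is half of chi-square up to a bounded
  error. What remains is to count lattice points: a shell of thickness \<open>1\<close> in chi-square contains a
  cube whose sides have order \<open>sqrt (n / ln n)\<close> (lemma \<open>chi_square_shell_count\<close>). For the Type II error each
  lattice point is paired with the box of half-side \<open>1 / sqrt n\<close> of parameters under which it is typical, and
  the prior mass of that box is known because the Dirichlet density is bounded above and below near
  \<open>p0\<close>.
\<close>

section \<open>Stirling's bounds and the entropy function\<close>

text \<open>The defect \<open>s n = ln n! - (n + 1/2) ln n + n\<close> decreases, and the midpoint and trapezoidal
  bounds for \<open>ln (n + 1) - ln n\<close> make each decrement at most a quarter of \<open>1/n - 1/(n + 1)\<close>.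
  Telescoping from \<open>s 1 = 1\<close> keeps \<open>s n\<close> between \<open>3/4\<close> and \<open>1\<close>.\<close>
lemma fact_Stirling_bounds:
  assumes "1 \<le> n"
  shows "exp (3/4) * (sqrt n * (n / exp 1) ^ n) \<le> fact n"
    and "fact n \<le> exp 1 * (sqrt n * (real n / exp 1) ^ n)"
proof -
  define s where "s n = ln (fact n) + real n - (real n + 1/2) * ln (real n)" for n :: nat
  have *: "s (Suc n) \<le> s n \<and> s n - s (Suc n) \<le> (1 / real n - 1 / real (Suc n)) / 4"
    if n: "1 \<le> n" for n
  proof -
    have "ln (fact (Suc n) :: real) = ln (real n + 1) + ln (fact n)"
      unfolding fact_Suc of_nat_mult by (subst ln_mult) (auto simp: add.commute)
    then have eq: "s n - s (Suc n) = (real n + 1/2) * (ln (real n + 1) - ln (real n)) - 1"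
      unfolding s_def by (simp add: algebra_simps del: fact_Suc)
    have "2 / (2 * real n + 1) \<le> ln (real n + 1) - ln (real n)"
      using ln_inverse_approx_ge[of "real n" "real n + 1"] n by (simp add: algebra_simps)
    then have "(real n + 1/2) * (2 / (2 * real n + 1)) \<le> (real n + 1/2) * (ln (real n + 1) - ln (real n))"
      by (intro mult_left_mono) auto
    moreover have "(real n + 1/2) * (2 / (2 * real n + 1)) = 1"
      using n by (simp add: field_simps)
    ultimately have 1: "0 \<le> s n - s (Suc n)" unfolding eq by linarith
    have "ln (real n + 1) - ln (real n) \<le> (inverse (real n) + inverse (real n + 1)) / 2"
      using ln_inverse_approx_le[of "real n" 1] n by simp
    then have "(real n + 1/2) * (ln (real n + 1) - ln (real n))
        \<le> (real n + 1/2) * ((inverse (real n) + inverse (real n + 1)) / 2)"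
      by (intro mult_left_mono) auto
    also have "\<dots> = 1 + (1 / real n - 1 / real (Suc n)) / 4"
      using n by (simp add: divide_simps) (simp add: algebra_simps)
    finally show ?thesis using 1 eq by linarith
  qed
  have "s n \<le> 1 \<and> 3/4 + 1 / (4 * real n) \<le> s n"
    using assms
  proof (induction n rule: dec_induct)
    case base
    show ?case by (simp add: s_def)
  next
    case (step n)
    have "1 / (4 * real x) = 1 / real x / 4" for x :: nat by simp
    then show ?case using step.IH * [OF step.hyps(1)] by (simp only:) (auto simp: diff_divide_distrib)
  qed
  moreover have "0 \<le> 1 / (4 * real n)" by simp
  ultimately have s: "s n \<le> 1" "3/4 \<le> s n" by linarith+
  have "fact n = exp (ln (fact n :: real))" by simp
  also have "ln (fact n) = s n + (ln (sqrt n) + real n * (ln n - 1))"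
    using assms by (simp add: s_def ln_sqrt algebra_simps)
  also have "exp \<dots> = exp (s n) * (sqrt n * (n / exp 1) ^ n)"
    using assms by (simp add: exp_add exp_of_nat_mult exp_diff)
  finally have f: "fact n = exp (s n) * (sqrt n * (real n / exp 1) ^ n)" .
  show "exp (3/4) * (sqrt n * (real n / exp 1) ^ n) \<le> fact n"
       "fact n \<le> exp 1 * (sqrt n * (real n / exp 1) ^ n)"
    unfolding f using s by (intro mult_right_mono; simp)+
qed

text \<open>The error on the left has derivative \<open>ln (1 + z) - z\<close>, which is \<open>O(z\<^sup>2)\<close>.\<close>
lemma entropy_quadratic_approx:
  fixes y :: real
  assumes "\<bar>y\<bar> \<le> 1/2"
  shows "\<bar>(1 + y) * ln (1 + y) - y - y\<^sup>2 / 2\<bar> \<le> 2 * \<bar>y\<bar> ^ 3"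
proof -
  let ?f = "\<lambda>y :: real. (1 + y) * ln (1 + y) - y - y\<^sup>2 / 2"
  have "norm (?f y - ?f 0) \<le> (2 * \<bar>y\<bar>\<^sup>2) * norm (y - 0)"
  proof (rule field_differentiable_bound)
    show "convex {-\<bar>y\<bar>..\<bar>y\<bar>}" by simp
    fix z :: real assume z: "z \<in> {-\<bar>y\<bar>..\<bar>y\<bar>}"
    then have z': "\<bar>z\<bar> \<le> \<bar>y\<bar>" "\<bar>z\<bar> \<le> 1/2" using assms by auto
    then have "0 < 1 + z" by auto
    then show "(?f has_field_derivative (ln (1 + z) - z)) (at z within {-\<bar>y\<bar>..\<bar>y\<bar>})"
      by (auto intro!: derivative_eq_intros)
    have "\<bar>ln (1 + z) - z\<bar> \<le> 2 * z\<^sup>2"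
      by (rule abs_ln_one_plus_x_minus_x_bound[OF z'(2)])
    also have "\<dots> \<le> 2 * \<bar>y\<bar>\<^sup>2" using z'(1) by (simp add: abs_le_square_iff)
    finally show "norm (ln (1 + z) - z) \<le> 2 * \<bar>y\<bar>\<^sup>2" by simp
  qed auto
  then show ?thesis by (simp add: power2_eq_square power3_eq_cube)
qed

section \<open>Cell counts of a categorical sample\<close>
definition compositions :: "nat \<Rightarrow> nat \<Rightarrow> (nat \<Rightarrow> nat) set" where
  "compositions k n = {m \<in> extensional {1..k}. (\<Sum>j\<in>{1..k}. m j) = n}"

definition cell_counts :: "nat \<Rightarrow> nat \<Rightarrow> (nat \<Rightarrow> nat) \<Rightarrow> nat \<Rightarrow> nat" where
  "cell_counts k n X = restrict (category_count n X) {1..k}"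

definition multinomial_prob :: "nat \<Rightarrow> nat \<Rightarrow> (nat \<Rightarrow> real) \<Rightarrow> (nat \<Rightarrow> nat) \<Rightarrow> real" where
  "multinomial_prob k n p m = fact n * (\<Prod>j\<in>{1..k}. p j ^ m j / fact (m j))"

definition chi_square :: "nat \<Rightarrow> nat \<Rightarrow> (nat \<Rightarrow> real) \<Rightarrow> (nat \<Rightarrow> nat) \<Rightarrow> real" where
  "chi_square k n p m = (\<Sum>j\<in>{1..k}. (real (m j) - real n * p j)\<^sup>2 / (real n * p j))"

lemma pearson_eq_chi_square: "pearson k n p X = chi_square k n p (cell_counts k n X)"
  unfolding pearson_def chi_square_def cell_counts_def by (intro sum.cong) auto

lemma compositions_le: "m \<in> compositions k n \<Longrightarrow> j \<in> {1..k} \<Longrightarrow> m j \<le> n"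
  unfolding compositions_def using member_le_sum[of j "{1..k}" m] by auto

lemma finite_compositions [simp]: "finite (compositions k n)"
proof (rule finite_subset)
  show "compositions k n \<subseteq> PiE {1..k} (\<lambda>_. {..n})"
    by (intro subsetI PiE_I) (auto intro: compositions_le simp: compositions_def extensional_def)
qed (intro finite_PiE; simp)

lemma multinomial_prob_nonneg: "p \<in> prob_simplex k \<Longrightarrow> 0 \<le> multinomial_prob k n p m"
  unfolding multinomial_prob_def prob_simplex_def
  by (auto intro!: mult_nonneg_nonneg prod_nonneg divide_nonneg_nonneg)

lemma pmf_categorical:
  assumes "p \<in> prob_simplex k"
  shows "pmf (categorical_pmf k p) j = (if j \<in> {1..k} then p j else 0)"
proof -
  have nn: "0 \<le> (if j \<in> {1..k} then p j else 0)" for j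
    using assms by (auto simp: prob_simplex_def)
  have "(\<integral>\<^sup>+ x. ennreal (if x \<in> {1..k} then p x else 0) \<partial>count_space UNIV)
      = (\<integral>\<^sup>+ x. ennreal (p x) * indicator {1..k} x \<partial>count_space UNIV)"
    by (intro nn_integral_cong) (auto simp: indicator_def)
  also have "\<dots> = (\<Sum>x\<in>{1..k}. ennreal (p x))"
    by (simp add: nn_integral_count_space_indicator[symmetric] nn_integral_count_space_finite)
  also have "\<dots> = ennreal (\<Sum>x\<in>{1..k}. p x)"
    using assms by (intro sum_ennreal) (auto simp: prob_simplex_def)
  also have "\<dots> = 1" using assms by (simp add: prob_simplex_def)
  finally have "(\<integral>\<^sup>+ x. ennreal (if x \<in> {1..k} then p x else 0) \<partial>count_space UNIV) = 1" .
  from pmf_embed_pmf[OF nn this] show ?thesis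
    using assms by (simp add: categorical_pmf_def)
qed

lemma set_iid_sample:
  assumes "p \<in> prob_simplex k"
  shows "set_pmf (iid_sample k n p) \<subseteq> PiE_dflt {1..n} 0 (\<lambda>_. {1..k})"
proof -
  have "set_pmf (categorical_pmf k p) \<subseteq> {1..k}"
    using pmf_categorical[OF assms] by (auto simp: set_pmf_eq split: if_splits)
  then show ?thesis
    unfolding iid_sample_def
    by (subst set_Pi_pmf) (auto simp: PiE_dflt_def o_def)
qed

lemma cell_counts_in_compositions:
  assumes "X \<in> PiE_dflt {1..n} 0 (\<lambda>_. {1..k})"
  shows "cell_counts k n X \<in> compositions k n"
proof -
  have "(\<Sum>j\<in>{1..k}. card {i \<in> {1..n}. X i = j}) = card (\<Union>j\<in>{1..k}. {i \<in> {1..n}. X i = j})"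
    by (intro card_UN_disjoint[symmetric]) auto
  also have "(\<Union>j\<in>{1..k}. {i \<in> {1..n}. X i = j}) = {1..n}"
    using assms by (auto simp: PiE_dflt_def)
  finally show ?thesis by (simp add: compositions_def cell_counts_def category_count_def)
qed

text \<open>Read as a word of length \<open>n\<close>, a sample with counts \<open>m\<close> is a permutation of the multiset that
  contains each \<open>j\<close> exactly \<open>m j\<close> times, and the library counts those.\<close>
lemma card_samples_with_cell_counts:
  assumes m: "m \<in> compositions k n"
  shows "card {X \<in> PiE_dflt {1..n} 0 (\<lambda>_. {1..k}). cell_counts k n X = m} * (\<Prod>j\<in>{1..k}. fact (m j))
    = (fact n :: nat)" (is "card ?S * _ = _")
proof -
  define M where "M = (\<Sum>j\<in>{1..k}. replicate_mset (m j) j)"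
  have cM: "count M j = (if j \<in> {1..k} then m j else 0)" for j
    unfolding M_def count_sum by (simp add: sum.delta)
  have sM: "size M = n" using m by (simp add: M_def size_multiset_sum compositions_def)
  have cnt: "count (mset (map X [1..<Suc n])) j = category_count n X j" for X j
  proof -
    have "count (mset (map X [1..<Suc n])) j = length (filter (\<lambda>i. X i = j) [1..<Suc n])"
      unfolding count_mset count_list_eq_length_filter filter_map length_map
      by (simp only: o_def eq_commute[of j])
    also have "\<dots> = card ({i. X i = j} \<inter> {1..n})"
      by (subst distinct_length_filter) (auto simp only: distinct_upt set_upt atLeastLessThanSuc_atLeastAtMost)
    also have "{i. X i = j} \<inter> {1..n} = {i \<in> {1..n}. X i = j}" by auto
    finally show ?thesis by (simp add: category_count_def)
  qed
  have "bij_betw (\<lambda>X. map X [1..<Suc n]) ?S (permutations_of_multiset M)"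
  proof (rule bij_betw_byWitness[where f' = "\<lambda>xs i. if i \<in> {1..n} then xs ! (i - 1) else 0"])
    show "\<forall>X\<in>?S. (\<lambda>i. if i \<in> {1..n} then map X [1..<Suc n] ! (i - 1) else 0) = X"
      by (auto simp: PiE_dflt_def fun_eq_iff simp del: upt_Suc)
    show "\<forall>xs\<in>permutations_of_multiset M.
        map (\<lambda>i. if i \<in> {1..n} then xs ! (i - 1) else 0) [1..<Suc n] = xs"
      using sM by (auto simp: permutations_of_multiset_def intro!: nth_equalityI simp del: upt_Suc)
    show "(\<lambda>X. map X [1..<Suc n]) ` ?S \<subseteq> permutations_of_multiset M"
    proof safe
      fix X assume X: "X \<in> PiE_dflt {1..n} 0 (\<lambda>_. {1..k})" "m = cell_counts k n X"
      have "category_count n X j = 0" if "j \<notin> {1..k}" for j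
        using X(1) that by (auto simp: category_count_def PiE_dflt_def)
      then have "mset (map X [1..<Suc n]) = M"
        by (intro multiset_eqI, unfold cnt cM) (auto simp: X(2) cell_counts_def)
      then show "map X [1..<Suc n] \<in> permutations_of_multiset M"
        by (simp add: permutations_of_multiset_def)
    qed
    show "(\<lambda>xs i. if i \<in> {1..n} then xs ! (i - 1) else 0) ` permutations_of_multiset M \<subseteq> ?S"
    proof safe
      fix xs assume xs: "xs \<in> permutations_of_multiset M"
      let ?X = "\<lambda>i. if i \<in> {1..n} then xs ! (i - 1) else 0"
      have ms: "mset xs = M" using xs by (simp add: permutations_of_multiset_def)
      have len: "length xs = n" using ms sM by (metis size_mset)
      have "map ?X [1..<Suc n] = xs"
        using len by (auto intro!: nth_equalityI simp del: upt_Suc)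
      then have cc: "category_count n ?X j = count M j" for j
        using cnt[of ?X j] ms by simp
      have "set xs \<subseteq> {1..k}"
        using cM ms by (metis set_mset_mset count_eq_zero_iff subsetI)
      then show "?X \<in> PiE_dflt {1..n} 0 (\<lambda>_. {1..k})"
        using len by (auto simp: PiE_dflt_def subset_iff)
      show "cell_counts k n ?X = m"
        unfolding cell_counts_def cc cM using m
        by (auto simp: compositions_def extensional_def fun_eq_iff restrict_def)
    qed
  qed
  then have "card ?S = card (permutations_of_multiset M)" by (rule bij_betw_same_card)
  moreover have "(\<Prod>x\<in>set_mset M. fact (count M x)) = (\<Prod>j\<in>{1..k}. fact (m j) :: nat)"
  proof (rule prod.mono_neutral_cong_left)
    show "set_mset M \<subseteq> {1..k}" using cM by (metis count_eq_zero_iff subsetI)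
    show "\<forall>i\<in>{1..k} - set_mset M. fact (m i) = (1 :: nat)"
      using cM by (metis DiffE count_eq_zero_iff fact_0)
    show "\<And>x. x \<in> set_mset M \<Longrightarrow> fact (count M x) = (fact (m x) :: nat)"
      using cM by (metis count_eq_zero_iff)
  qed simp
  ultimately show ?thesis using card_permutations_of_multiset_aux[of M] sM by simp
qed

text \<open>The probability of a sample depends on its counts only, so the samples can be grouped by them.\<close>
lemma prob_cell_counts:
  assumes p: "p \<in> prob_simplex k"
  shows "measure_pmf.prob (iid_sample k n p) {X. Q (cell_counts k n X)} =
    (\<Sum>m | m \<in> compositions k n \<and> Q m. multinomial_prob k n p m)"
proof -
  let ?P = "PiE_dflt {1..n} 0 (\<lambda>_. {1..k})"
  have fin: "finite ?P" by (intro finite_PiE_dflt) auto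
  have pmf: "pmf (iid_sample k n p) X = (\<Prod>j\<in>{1..k}. p j ^ cell_counts k n X j)" if X: "X \<in> ?P" for X
  proof -
    have "pmf (iid_sample k n p) X = (\<Prod>i\<in>{1..n}. pmf (categorical_pmf k p) (X i))"
      unfolding iid_sample_def using X by (intro pmf_Pi') (auto simp: PiE_dflt_def)
    also have "\<dots> = (\<Prod>i\<in>{1..n}. p (X i))"
      using X by (intro prod.cong refl) (auto simp: pmf_categorical[OF p] PiE_dflt_def)
    also have "\<dots> = (\<Prod>j\<in>{1..k}. \<Prod>i\<in>{i \<in> {1..n}. X i = j}. p (X i))"
      using X by (intro prod.group[symmetric]) (auto simp: PiE_dflt_def)
    also have "\<dots> = (\<Prod>j\<in>{1..k}. p j ^ cell_counts k n X j)"
      by (intro prod.cong) (auto simp: cell_counts_def category_count_def)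
    finally show ?thesis .
  qed
  have "measure_pmf.prob (iid_sample k n p) {X. Q (cell_counts k n X)}
      = measure_pmf.prob (iid_sample k n p) {X \<in> ?P. Q (cell_counts k n X)}"
    using set_iid_sample[OF p]
    by (intro measure_pmf.finite_measure_eq_AE) (auto simp: AE_measure_pmf_iff)
  also have "\<dots> = (\<Sum>X | X \<in> ?P \<and> Q (cell_counts k n X). pmf (iid_sample k n p) X)"
    using fin by (intro measure_measure_pmf_finite) auto
  also have "\<dots> = (\<Sum>m | m \<in> compositions k n \<and> Q m.
      \<Sum>X\<in>{X \<in> {X \<in> ?P. Q (cell_counts k n X)}. cell_counts k n X = m}. pmf (iid_sample k n p) X)"
    using fin by (intro sum.group[symmetric]) (auto intro: cell_counts_in_compositions)
  also have "\<dots> = (\<Sum>m | m \<in> compositions k n \<and> Q m. multinomial_prob k n p m)"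
  proof (intro sum.cong refl)
    fix m assume m: "m \<in> {m. m \<in> compositions k n \<and> Q m}"
    have "(\<Sum>X\<in>{X \<in> {X \<in> ?P. Q (cell_counts k n X)}. cell_counts k n X = m}. pmf (iid_sample k n p) X)
        = (\<Sum>X\<in>{X \<in> ?P. cell_counts k n X = m}. (\<Prod>j\<in>{1..k}. p j ^ m j))"
      using m pmf by (intro sum.cong) auto
    also have "\<dots> = real (card {X \<in> ?P. cell_counts k n X = m}) * (\<Prod>j\<in>{1..k}. p j ^ m j)"
      by simp
    also have "real (card {X \<in> ?P. cell_counts k n X = m}) = fact n / (\<Prod>j\<in>{1..k}. fact (m j))"
      using arg_cong[OF card_samples_with_cell_counts[of m k n], of real] m
      by (simp add: field_simps of_nat_prod)
    finally show "(\<Sum>X\<in>{X \<in> {X \<in> ?P. Q (cell_counts k n X)}. cell_counts k n X = m}. pmf (iid_sample k n p) X)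
        = multinomial_prob k n p m"
      by (simp add: multinomial_prob_def prod_dividef)
  qed
  finally show ?thesis .
qed

text \<open>A single category count is binomial, so this is Hoeffding's inequality.\<close>
lemma prob_category_count_deviation:
  assumes p: "p \<in> prob_simplex k" and j: "j \<in> {1..k}" and t: "0 \<le> t" and n: "1 \<le> n"
  shows "measure_pmf.prob (iid_sample k n p) {X. t \<le> \<bar>real (category_count n X j) - real n * p j\<bar>}
    \<le> 2 * exp (- 2 * t\<^sup>2 / real n)"
proof -
  have pj: "p j \<in> {0..1}"
    using p j member_le_sum[of j "{1..k}" p] by (auto simp: prob_simplex_def)
  have bern: "map_pmf (\<lambda>x. x = j) (categorical_pmf k p) = bernoulli_pmf (p j)"
  proof (rule pmf_eqI)
    have 1: "pmf (map_pmf (\<lambda>x. x = j) (categorical_pmf k p)) True = p j"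
      using j pmf_categorical[OF p, of j] by (simp add: pmf_map vimage_def pmf.rep_eq)
    have "pmf (map_pmf (\<lambda>x. x = j) (categorical_pmf k p)) b = pmf (bernoulli_pmf (p j)) b" for b
    proof (cases b)
      case True then show ?thesis using 1 pj by simp
    next
      case False
      then show ?thesis using 1 pj by (simp add: pmf_False_conv_True)
    qed
    then show "pmf (map_pmf (\<lambda>x. x = j) (categorical_pmf k p)) i = pmf (bernoulli_pmf (p j)) i" for i .
  qed
  have "binomial_pmf n (p j) =
      map_pmf (\<lambda>f. card {i \<in> {1..n}. f i}) (Pi_pmf {1..n} (0 = j) (\<lambda>_. bernoulli_pmf (p j)))"
    using pj by (intro binomial_pmf_altdef') auto
  also have "Pi_pmf {1..n} (0 = j) (\<lambda>_. bernoulli_pmf (p j)) = map_pmf (\<lambda>h. (\<lambda>x. x = j) \<circ> h) (iid_sample k n p)"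
    unfolding bern[symmetric] iid_sample_def by (intro Pi_pmf_map) auto
  finally have b: "binomial_pmf n (p j) = map_pmf (\<lambda>X. category_count n X j) (iid_sample k n p)"
    by (simp add: map_pmf_comp category_count_def)
  have "measure_pmf.prob (binomial_pmf n (p j)) {x. t \<le> \<bar>real x - real n * p j\<bar>} \<le> 2 * exp (- 2 * t\<^sup>2 / real n)"
    using n t pj by (intro binomial_distribution.prob_abs_ge) (auto simp: binomial_distribution_def)
  then show ?thesis by (simp add: b vimage_def)
qed

section \<open>Multinomial probabilities and relative entropy\<close>

text \<open>This is \<open>n\<close> times the Kullback-Leibler divergence of \<open>m / n\<close> from \<open>p\<close>.\<close>
definition scaled_entropy :: "nat \<Rightarrow> nat \<Rightarrow> (nat \<Rightarrow> real) \<Rightarrow> (nat \<Rightarrow> nat) \<Rightarrow> real" where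
  "scaled_entropy k n p m = (\<Sum>j\<in>{1..k}. real (m j) * ln (real (m j) / (real n * p j)))"

text \<open>As a function of \<open>p\<close>, the probability of the counts \<open>m\<close> is \<open>exp (- scaled_entropy)\<close> times its
  maximal value, attained at \<open>p = m / n\<close>. Stirling's bounds for each factorial turn this maximum into
  \<open>sqrt n / (\<Prod>j. sqrt (m j))\<close> up to a constant; it is at least of order \<open>n powr (- (k - 1) / 2)\<close> because
  \<open>m j \<le> n\<close>, and at most of that order because \<open>m j \<ge> \<delta> n\<close>.\<close>
lemma multinomial_prob_bounds:
  assumes n: "1 \<le> n" and k: "1 \<le> k" and m: "m \<in> compositions k n" and \<delta>: "0 < \<delta>"
    and mpos: "\<And>j. j \<in> {1..k} \<Longrightarrow> 0 < m j \<and> \<delta> * real n \<le> real (m j)"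
    and ppos: "\<And>j. j \<in> {1..k} \<Longrightarrow> 0 < p j"
  shows "exp (3/4 - real k) * real n powr (- (real k - 1) / 2) * exp (- scaled_entropy k n p m)
      \<le> multinomial_prob k n p m"
    and "multinomial_prob k n p m
      \<le> exp 1 * \<delta> powr (- real k / 2) * real n powr (- (real k - 1) / 2) * exp (- scaled_entropy k n p m)"
proof -
  define T where "T j = exp (real (m j) - real (m j) * ln n - real (m j) * ln (real (m j) / (real n * p j)))" for j
  have summ: "(\<Sum>j\<in>{1..k}. real (m j)) = real n"
    using m by (simp add: compositions_def flip: of_nat_sum)
  have prodT: "(\<Prod>j\<in>{1..k}. T j) = exp (real n - real n * ln n) * exp (- scaled_entropy k n p m)"
    unfolding T_def scaled_entropy_def using summ
    by (simp add: exp_sum[symmetric] exp_add[symmetric] sum_subtractf flip: sum_distrib_right)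
  have nn: "(real n / exp 1) ^ n = exp (- (real n - real n * ln n))"
    using n exp_of_nat_mult[of n "1::real"] by (simp add: exp_diff exp_of_nat_mult power_divide)
  have T: "p j ^ m j = T j * (real (m j) / exp 1) ^ m j" if j: "j \<in> {1..k}" for j
  proof -
    have pj: "0 < p j" "0 < real (m j)" using ppos[OF j] mpos[OF j] by auto
    have "T j * (real (m j) / exp 1) ^ m j =
        exp (real (m j) - real (m j) * ln n - real (m j) * ln (real (m j) / (real n * p j)))
        * exp (real (m j) * (ln (real (m j)) - 1))"
      using pj by (simp add: T_def exp_of_nat_mult exp_diff)
    also have "\<dots> = exp (real (m j) * ln (p j))"
      using pj n by (simp add: exp_add[symmetric] ln_div ln_mult algebra_simps)
    also have "\<dots> = p j ^ m j" using pj by (simp add: exp_of_nat_mult)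
    finally show ?thesis by simp
  qed
  have lo: "exp (-1) * (1 / sqrt (real n)) * T j \<le> p j ^ m j / fact (m j)" if j: "j \<in> {1..k}" for j
  proof -
    have mj: "1 \<le> m j" using mpos[OF j] by simp
    have Tp: "0 < T j" by (simp add: T_def)
    let ?Q = "(real (m j) / exp 1) ^ m j"
    have Q: "0 < ?Q" using mj by simp
    have "fact (m j) \<le> exp 1 * (sqrt (m j) * ?Q)" by (rule fact_Stirling_bounds[OF mj])
    also have "\<dots> \<le> exp 1 * (sqrt n * ?Q)"
      using compositions_le[OF m j] Q by (intro mult_left_mono mult_right_mono) auto
    finally have "p j ^ m j / (exp 1 * (sqrt n * ?Q)) \<le> p j ^ m j / fact (m j)"
      using ppos[OF j] n Q by (intro divide_left_mono) auto
    also have "p j ^ m j / (exp 1 * (sqrt n * ?Q)) = exp (-1) * (1 / sqrt (real n)) * T j"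
      using Q unfolding T[OF j] by (simp add: exp_minus field_simps)
    finally show ?thesis .
  qed
  have up: "p j ^ m j / fact (m j) \<le> (1 / sqrt (\<delta> * real n)) * T j" if j: "j \<in> {1..k}" for j
  proof -
    have mj: "1 \<le> m j" using mpos[OF j] by simp
    have Tp: "0 < T j" by (simp add: T_def)
    let ?Q = "(real (m j) / exp 1) ^ m j"
    have Q: "0 < ?Q" using mj by simp
    have "sqrt (\<delta> * n) * ?Q \<le> sqrt (m j) * ?Q"
      using mpos[OF j] Q by (intro mult_right_mono) auto
    also have "\<dots> \<le> exp (3/4) * (sqrt (m j) * ?Q)"
      using mult_right_mono[of 1 "exp (3/4)" "sqrt (m j) * ?Q"] Q by simp
    also have "\<dots> \<le> fact (m j)" by (rule fact_Stirling_bounds[OF mj])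
    finally have "p j ^ m j / fact (m j) \<le> p j ^ m j / (sqrt (\<delta> * n) * ?Q)"
      using ppos[OF j] n Q \<delta> by (intro divide_left_mono) auto
    also have "\<dots> = (1 / sqrt (\<delta> * real n)) * T j"
      using Q unfolding T[OF j] by (simp add: field_simps)
    finally show ?thesis .
  qed
  have powk: "sqrt n * (1 / sqrt n) ^ k = real n powr (- (real k - 1) / 2)"
  proof -
    have "sqrt n * (1 / sqrt n) ^ k = n powr (1/2) * ((n powr (-1/2)) powr k)"
      using n by (simp add: powr_half_sqrt[symmetric] powr_minus_divide powr_realpow)
    also have "\<dots> = n powr (1/2 + - real k / 2)"
      unfolding powr_powr powr_add by simp
    also have "1/2 + - real k / 2 = - (real k - 1) / 2" by (simp add: field_simps)
    finally show ?thesis .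
  qed
  have nlogn: "exp (- (real n - real n * ln n)) * exp (real n - real n * ln n) = 1"
    by (simp flip: exp_add)
  have expk: "exp (3/4 - real k) = exp (3/4) * exp (-1) ^ k"
    using exp_of_nat_mult[of k "-1::real"] exp_add[of "3/4" "- real k"] by simp
  have "exp (3/4 - real k) * real n powr (- (real k - 1) / 2) * exp (- scaled_entropy k n p m)
      = exp (3/4) * (sqrt n * (real n / exp 1) ^ n) * (\<Prod>j\<in>{1..k}. exp (-1) * (1 / sqrt (real n)) * T j)"
    unfolding prod.distrib prodT powk[symmetric] nn expk using nlogn
    by (simp add: mult_ac)
  also have "\<dots> \<le> fact n * (\<Prod>j\<in>{1..k}. p j ^ m j / fact (m j))"
    by (intro mult_mono fact_Stirling_bounds[OF n] prod_mono prod_nonneg conjI lo mult_nonneg_nonneg)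
       (auto simp: T_def)
  finally show "exp (3/4 - real k) * real n powr (- (real k - 1) / 2) * exp (- scaled_entropy k n p m)
      \<le> multinomial_prob k n p m" by (simp add: multinomial_prob_def)
  have dk: "sqrt n * (1 / sqrt (\<delta> * n)) ^ k = \<delta> powr (- real k / 2) * n powr (- (real k - 1) / 2)"
  proof -
    have "sqrt n * (1 / sqrt (\<delta> * n)) ^ k = (1 / sqrt \<delta>) ^ k * (sqrt n * (1 / sqrt n) ^ k)"
      by (simp add: real_sqrt_mult power_mult_distrib power_divide)
    also have "(1 / sqrt \<delta>) ^ k = (\<delta> powr (-1/2)) powr k"
      using \<delta> by (simp add: powr_half_sqrt[symmetric] powr_minus_divide powr_realpow)
    also have "\<dots> = \<delta> powr (- real k / 2)" unfolding powr_powr by simp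
    finally show ?thesis unfolding powk .
  qed
  have "multinomial_prob k n p m
      \<le> exp 1 * (sqrt n * (real n / exp 1) ^ n) * (\<Prod>j\<in>{1..k}. (1 / sqrt (\<delta> * real n)) * T j)"
    unfolding multinomial_prob_def using ppos \<delta>
    by (intro mult_mono fact_Stirling_bounds[OF n] prod_mono prod_nonneg conjI up)
       (auto intro!: divide_nonneg_nonneg prod_nonneg simp: less_imp_le)
  also have "\<dots> = exp 1 * (sqrt n * (1 / sqrt (\<delta> * n)) ^ k)
      * (exp (- (real n - real n * ln n)) * exp (real n - real n * ln n)) * exp (- scaled_entropy k n p m)"
    unfolding prod.distrib prodT nn by simp
  finally show "multinomial_prob k n p m
      \<le> exp 1 * \<delta> powr (- real k / 2) * real n powr (- (real k - 1) / 2) * exp (- scaled_entropy k n p m)"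
    unfolding dk nlogn by (simp add: mult.assoc)
qed

text \<open>In the relative deviations \<open>y j = (m j - n p j) / (n p j)\<close> the entropy is the sum of the terms
  \<open>n p j (1 + y j) ln (1 + y j)\<close>. Their linear parts cancel, since counts and expected counts have the
  same total; their quadratic parts add up to half of chi-square, and the rest is cubic.\<close>
lemma scaled_entropy_approx:
  assumes n: "1 \<le> n" and m: "m \<in> compositions k n" and p: "p \<in> prob_simplex k" and \<delta>: "0 < \<delta>"
    and pd: "\<And>j. j \<in> {1..k} \<Longrightarrow> \<delta> \<le> p j"
    and dev: "\<And>j. j \<in> {1..k} \<Longrightarrow> \<bar>real (m j) - real n * p j\<bar> \<le> r"
    and r: "r \<le> real n * \<delta> / 2"
  shows "\<bar>scaled_entropy k n p m - chi_square k n p m / 2\<bar> \<le> 2 * real k * r ^ 3 / (real n * \<delta>)\<^sup>2"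
proof -
  define y where "y j = (real (m j) - real n * p j) / (real n * p j)" for j
  define g where "g j = real n * p j * ((1 + y j) * ln (1 + y j) - y j - (y j)\<^sup>2 / 2)" for j
  have sum0: "(\<Sum>j\<in>{1..k}. real n * p j * y j) = 0"
  proof -
    have "(\<Sum>j\<in>{1..k}. real n * p j * y j) = (\<Sum>j\<in>{1..k}. real (m j) - real n * p j)"
      using n pd \<delta> by (intro sum.cong refl) (force simp: y_def)
    also have "\<dots> = 0"
      using m p by (simp add: sum_subtractf compositions_def prob_simplex_def flip: of_nat_sum sum_distrib_left)
    finally show ?thesis .
  qed
  have eq: "real (m j) * ln (real (m j) / (real n * p j)) - (real (m j) - real n * p j)\<^sup>2 / (real n * p j) / 2
      = g j + real n * p j * y j" if j: "j \<in> {1..k}" for j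
  proof -
    have np: "0 < real n * p j" using n pd[OF j] \<delta> by auto
    then have 1: "real (m j) / (real n * p j) = 1 + y j" "real (m j) = real n * p j * (1 + y j)"
      by (simp_all add: y_def diff_divide_distrib ring_distribs zero_less_mult_iff)
    have 2: "(real (m j) - real n * p j)\<^sup>2 / (real n * p j) = real n * p j * (y j)\<^sup>2"
      using np unfolding 1(2) by (simp add: field_simps power2_eq_square)
    show ?thesis unfolding 2 unfolding 1(1) unfolding 1(2) g_def by (simp add: algebra_simps)
  qed
  have "scaled_entropy k n p m - chi_square k n p m / 2 = (\<Sum>j\<in>{1..k}. g j + real n * p j * y j)"
    unfolding scaled_entropy_def chi_square_def sum_divide_distrib sum_subtractf[symmetric]
    by (intro sum.cong refl eq)
  also have "\<dots> = (\<Sum>j\<in>{1..k}. g j)" by (simp only: sum.distrib sum0 add_0_right)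
  finally have "\<bar>scaled_entropy k n p m - chi_square k n p m / 2\<bar> \<le> (\<Sum>j\<in>{1..k}. \<bar>g j\<bar>)"
    by simp
  also have "\<dots> \<le> (\<Sum>j\<in>{1..k}. 2 * r ^ 3 / (real n * \<delta>)\<^sup>2)"
  proof (intro sum_mono)
    fix j assume j: "j \<in> {1..k}"
    have nd: "0 < real n * \<delta>" using n \<delta> by auto
    have np: "real n * \<delta> \<le> real n * p j" using pd[OF j] by (simp add: mult_left_mono)
    have pos: "0 < n" "0 < p j" using n pd[OF j] \<delta> by auto
    have r0: "0 \<le> r" using dev[OF j] by linarith
    have ya: "\<bar>y j\<bar> * (real n * p j) = \<bar>real (m j) - real n * p j\<bar>"
      using pos by (simp add: y_def abs_mult)
    have "\<bar>y j\<bar> * (real n * p j) \<le> (1/2) * (real n * p j)"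
      unfolding ya using dev[OF j] r np by linarith
    then have yh: "\<bar>y j\<bar> \<le> 1/2" using np nd by (subst (asm) mult_le_cancel_right) auto
    have "\<bar>g j\<bar> \<le> real n * p j * (2 * \<bar>y j\<bar> ^ 3)"
      unfolding g_def abs_mult using pos entropy_quadratic_approx[OF yh] by (intro mult_mono) auto
    also have "\<dots> = 2 * (\<bar>y j\<bar> * (real n * p j)) ^ 3 / (real n * p j)\<^sup>2"
      using pos by (simp add: power2_eq_square power3_eq_cube)
    also have "\<dots> \<le> 2 * r ^ 3 / (real n * \<delta>)\<^sup>2"
      unfolding ya using dev[OF j] pos pd[OF j] \<delta> r0
      by (intro frac_le mult_left_mono power_mono mult_pos_pos zero_less_power) auto
    finally show "\<bar>g j\<bar> \<le> 2 * r ^ 3 / (real n * \<delta>)\<^sup>2" .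
  qed
  finally show ?thesis by simp
qed

section \<open>Lattice points in chi-square shells\<close>
lemma nat_interval_count:
  fixes u v :: real
  assumes "0 \<le> u" "u \<le> v"
  shows "finite {i :: nat. u \<le> real i \<and> real i \<le> v}"
    and "v - u - 1 \<le> real (card {i :: nat. u \<le> real i \<and> real i \<le> v})"
proof -
  have eq: "{i :: nat. u \<le> real i \<and> real i \<le> v} = {nat \<lceil>u\<rceil>..nat \<lfloor>v\<rfloor>}"
    using assms by (auto simp: nat_ceiling_le_eq le_nat_floor le_nat_iff) linarith+
  show "finite {i :: nat. u \<le> real i \<and> real i \<le> v}" unfolding eq by simp
  show "v - u - 1 \<le> real (card {i :: nat. u \<le> real i \<and> real i \<le> v})"
    unfolding eq using assms by (simp add: of_nat_diff) linarith
qed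

lemma nat_interval_count_upper:
  fixes u v :: real
  assumes "u \<le> v"
  shows "finite {i :: nat. u \<le> real i \<and> real i \<le> v}"
    and "real (card {i :: nat. u \<le> real i \<and> real i \<le> v}) \<le> v - u + 1"
proof -
  have fin: "finite {\<lceil>u\<rceil>..\<lfloor>v\<rfloor>}" by simp
  have inj: "inj_on int {i :: nat. u \<le> real i \<and> real i \<le> v}" by (simp add: inj_on_def)
  have sub: "int ` {i :: nat. u \<le> real i \<and> real i \<le> v} \<subseteq> {\<lceil>u\<rceil>..\<lfloor>v\<rfloor>}"
    by (auto simp: ceiling_le_iff le_floor_iff)
  show "finite {i :: nat. u \<le> real i \<and> real i \<le> v}"
    using finite_subset[OF sub fin] inj by (simp add: finite_image_iff)
  have "card {i :: nat. u \<le> real i \<and> real i \<le> v} \<le> card {\<lceil>u\<rceil>..\<lfloor>v\<rfloor>}"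
    using card_inj_on_le[OF inj sub fin] .
  then show "real (card {i :: nat. u \<le> real i \<and> real i \<le> v}) \<le> v - u + 1"
    using assms by simp linarith
qed

lemma sum_split_last:
  fixes f :: "nat \<Rightarrow> 'a :: comm_monoid_add"
  assumes "1 \<le> k"
  shows "sum f {1..k} = sum f {1..<k} + f k"
  using assms sum.atLeastLessThan_Suc[of 1 k f] by (simp add: atLeastLessThanSuc_atLeastAtMost)

lemma sqrt_power_eq_powr:
  assumes "0 < x" "1 \<le> k"
  shows "sqrt x ^ (k - Suc 0) = x powr ((real k - 1) / 2)"
proof -
  have "sqrt x ^ (k - 1) = (x powr (1/2)) powr real (k - 1)"
    using assms by (subst powr_realpow) (auto simp: powr_half_sqrt)
  then show ?thesis using assms by (simp add: powr_powr of_nat_diff)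
qed

text \<open>The discrete counterpart of \<open>simplex_point\<close>: the first \<open>k - 1\<close> counts are free and the last one
  is what remains of \<open>n\<close>.\<close>
definition complete_counts :: "nat \<Rightarrow> nat \<Rightarrow> (nat \<Rightarrow> nat) \<Rightarrow> nat \<Rightarrow> nat" where
  "complete_counts k n y = (\<lambda>j\<in>{1..k}. if j < k then y j else n - (\<Sum>i\<in>{1..<k}. y i))"

lemma complete_counts_in_compositions:
  assumes "1 \<le> k" "(\<Sum>i\<in>{1..<k}. y i) \<le> n"
  shows "complete_counts k n y \<in> compositions k n"
proof -
  have "(\<Sum>j\<in>{1..k}. complete_counts k n y j)
      = (\<Sum>j\<in>{1..<k}. complete_counts k n y j) + complete_counts k n y k"
    by (rule sum_split_last[OF assms(1)])
  also have "(\<Sum>j\<in>{1..<k}. complete_counts k n y j) = (\<Sum>j\<in>{1..<k}. y j)"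
    by (intro sum.cong) (auto simp: complete_counts_def)
  finally show ?thesis using assms by (simp add: compositions_def complete_counts_def)
qed

lemma inj_on_complete_counts: "inj_on (complete_counts k n) (PiE {1..<k} Y)"
proof (rule inj_onI)
  fix y z assume yz: "y \<in> PiE {1..<k} Y" "z \<in> PiE {1..<k} Y" "complete_counts k n y = complete_counts k n z"
  have "y j = z j" if "j \<in> {1..<k}" for j
    using fun_cong[OF yz(3), of j] that by (simp add: complete_counts_def)
  then show "y = z" using yz(1,2) by (auto intro: PiE_ext)
qed

context
  fixes k :: nat and p0 :: "nat \<Rightarrow> real"
  assumes k: "2 \<le> k" and p0: "p0 \<in> prob_simplex k" "\<forall>j\<in>{1..k}. 0 < p0 j"
begin

lemma p0_bounds: "\<exists>\<delta>. 0 < \<delta> \<and> \<delta> \<le> 1 \<and> (\<forall>j\<in>{1..k}. \<delta> \<le> p0 j \<and> p0 j \<le> 1)"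
proof -
  have le1: "p0 j \<le> 1" if "j \<in> {1..k}" for j
    using that member_le_sum[of j "{1..k}" p0] p0 by (auto simp: prob_simplex_def)
  have "0 < Min (p0 ` {1..k})" using k p0(2) by (subst Min_gr_iff) auto
  moreover have "\<forall>j\<in>{1..k}. Min (p0 ` {1..k}) \<le> p0 j" by auto
  moreover have "1 \<in> {1..k}" using k by simp
  moreover have "Min (p0 ` {1..k}) \<le> 1" using order_trans[OF _ le1[of 1]] k by simp
  ultimately show ?thesis using le1 by (intro exI[of _ "Min (p0 ` {1..k})"]) blast
qed

lemma chi_square_deviation:
  assumes n: "1 \<le> n" and j: "j \<in> {1..k}" and le: "chi_square k n p0 m \<le> s"
  shows "\<bar>real (m j) - real n * p0 j\<bar> \<le> sqrt (real n * s)"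
proof -
  have p: "0 < p0 j" "p0 j \<le> 1" using p0(2) j p0_bounds by auto
  have "(real (m j) - real n * p0 j)\<^sup>2 / (real n * p0 j) \<le> chi_square k n p0 m"
    unfolding chi_square_def using j p0(2)
    by (intro member_le_sum) (auto intro!: divide_nonneg_nonneg mult_nonneg_nonneg simp: less_imp_le)
  then have "(real (m j) - real n * p0 j)\<^sup>2 / (real n * p0 j) \<le> s" using le by simp
  then have *: "(real (m j) - real n * p0 j)\<^sup>2 \<le> s * (real n * p0 j)"
    using p n by (simp add: pos_divide_le_eq)
  moreover have "0 \<le> s"
  proof (rule ccontr)
    assume "\<not> 0 \<le> s"
    then have "s * (real n * p0 j) < 0" using p n by (simp add: mult_neg_pos)
    with * show False using zero_le_power2[of "real (m j) - real n * p0 j"] by linarith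
  qed
  ultimately have "(real (m j) - real n * p0 j)\<^sup>2 \<le> real n * s"
    using p n by (auto intro!: order_trans[OF *] mult_left_mono simp: mult.commute mult_left_le)
  then show ?thesis by (simp add: real_le_rsqrt)
qed

text \<open>Counts with \<open>chi_square \<le> B ln n\<close> deviate from their means by \<open>O(sqrt (n ln n))\<close>, so the cubic error
  of the entropy approximation is \<open>O((ln n) powr (3/2) / sqrt n)\<close>. It tends to \<open>0\<close>, hence half of
  chi-square can replace the entropy at the price of a constant factor.\<close>
lemma multinomial_prob_gaussian:
  assumes B: "0 < B"
  shows "\<exists>c>0. \<exists>C>0. \<forall>\<^sub>F n in sequentially. \<forall>m\<in>compositions k n. chi_square k n p0 m \<le> B * ln n \<longrightarrow>
    c * real n powr (- (real k - 1) / 2) * exp (- chi_square k n p0 m / 2) \<le> multinomial_prob k n p0 m \<and>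
    multinomial_prob k n p0 m \<le> C * real n powr (- (real k - 1) / 2) * exp (- chi_square k n p0 m / 2)"
proof -
  obtain \<delta> where \<delta>: "0 < \<delta>" "\<delta> \<le> 1" "\<And>j. j \<in> {1..k} \<Longrightarrow> \<delta> \<le> p0 j \<and> p0 j \<le> 1"
    using p0_bounds by auto
  define K where "K = real k"
  have K: "0 < K" using k by (simp add: K_def)
  have ev1: "\<forall>\<^sub>F n in sequentially. 2 * K * (sqrt (real n * (B * ln n))) ^ 3 / (real n * \<delta>)\<^sup>2 \<le> 1"
    using B \<delta>(1) K by real_asymp
  have ev2: "\<forall>\<^sub>F n in sequentially. sqrt (real n * (B * ln n)) \<le> real n * \<delta> / 2"
    using B \<delta>(1) by real_asymp
  let ?c = "exp (3/4 - real k) * exp (-1)"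
  let ?C = "exp 1 * (\<delta>/2) powr (- real k / 2) * exp 1"
  have "\<forall>\<^sub>F n in sequentially. \<forall>m\<in>compositions k n. chi_square k n p0 m \<le> B * ln n \<longrightarrow>
    ?c * real n powr (- (real k - 1) / 2) * exp (- chi_square k n p0 m / 2) \<le> multinomial_prob k n p0 m \<and>
    multinomial_prob k n p0 m \<le> ?C * real n powr (- (real k - 1) / 2) * exp (- chi_square k n p0 m / 2)"
    using ev1 ev2 eventually_ge_at_top[of 1]
  proof eventually_elim
    case (elim n)
    show ?case
    proof (intro ballI impI)
      fix m assume m: "m \<in> compositions k n" and chi: "chi_square k n p0 m \<le> B * ln n"
      have dev: "\<bar>real (m j) - real n * p0 j\<bar> \<le> sqrt (real n * (B * ln n))" if "j \<in> {1..k}" for j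
        using chi_square_deviation[OF elim(3) that chi] .
      have "\<bar>scaled_entropy k n p0 m - chi_square k n p0 m / 2\<bar>
          \<le> 2 * real k * (sqrt (real n * (B * ln n))) ^ 3 / (real n * \<delta>)\<^sup>2"
        using \<delta> dev elim by (intro scaled_entropy_approx[OF elim(3) m p0(1)]) auto
      then have ent: "\<bar>scaled_entropy k n p0 m - chi_square k n p0 m / 2\<bar> \<le> 1"
        using elim(1) unfolding K_def by linarith
      have mj: "0 < m j \<and> \<delta> / 2 * real n \<le> real (m j)" if j: "j \<in> {1..k}" for j
      proof -
        have "real n * \<delta> \<le> real n * p0 j" using \<delta>(3)[OF j] by (simp add: mult_left_mono)
        then have "\<delta> / 2 * real n \<le> real (m j)"
          using dev[OF j] elim(2) by (simp add: mult.commute)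
        moreover have "0 < \<delta> / 2 * real n" using \<delta>(1) elim(3) by simp
        ultimately show ?thesis by linarith
      qed
      note bnds = multinomial_prob_bounds[OF elim(3) _ m _ mj, of p0]
      let ?N = "real n powr (- (real k - 1) / 2)"
      have lo: "exp (3/4 - real k) * ?N * exp (- scaled_entropy k n p0 m) \<le> multinomial_prob k n p0 m"
        using k \<delta>(1) p0(2) by (intro bnds) auto
      have up: "multinomial_prob k n p0 m
          \<le> exp 1 * (\<delta>/2) powr (- real k / 2) * ?N * exp (- scaled_entropy k n p0 m)"
        using k \<delta>(1) p0(2) by (intro bnds) auto
      have "exp (-1) * exp (- chi_square k n p0 m / 2) \<le> exp (- scaled_entropy k n p0 m)"
        unfolding exp_add[symmetric] using ent by simp
      then have "exp (3/4 - real k) * ?N * (exp (-1) * exp (- chi_square k n p0 m / 2))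
          \<le> exp (3/4 - real k) * ?N * exp (- scaled_entropy k n p0 m)"
        by (intro mult_left_mono) auto
      with lo have 1: "?c * ?N * exp (- chi_square k n p0 m / 2) \<le> multinomial_prob k n p0 m"
        by (simp add: mult_ac)
      have "exp (- scaled_entropy k n p0 m) \<le> exp 1 * exp (- chi_square k n p0 m / 2)"
        unfolding exp_add[symmetric] using ent by simp
      then have "exp 1 * (\<delta>/2) powr (- real k / 2) * ?N * exp (- scaled_entropy k n p0 m)
          \<le> exp 1 * (\<delta>/2) powr (- real k / 2) * ?N * (exp 1 * exp (- chi_square k n p0 m / 2))"
        by (intro mult_left_mono) auto
      from order_trans[OF up this] have 2: "multinomial_prob k n p0 m \<le> ?C * ?N * exp (- chi_square k n p0 m / 2)"
        by argo
      show "?c * ?N * exp (- chi_square k n p0 m / 2) \<le> multinomial_prob k n p0 m \<and>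
        multinomial_prob k n p0 m \<le> ?C * ?N * exp (- chi_square k n p0 m / 2)"
        using 1 2 by simp
    qed
  qed
  moreover have "0 < ?c" "0 < ?C" using \<delta>(1) by auto
  ultimately show ?thesis by blast
qed

text \<open>If \<open>p\<close> is within \<open>1 / sqrt n\<close> of \<open>m / n\<close>, the counts \<open>m\<close> are only \<open>O(sqrt n)\<close> away from their means
  under \<open>p\<close>, and then the entropy is bounded: \<open>m\<close> is as likely as a typical value.\<close>
lemma multinomial_prob_lower_near:
  assumes B: "0 < B"
  shows "\<exists>c>0. \<forall>\<^sub>F n in sequentially. \<forall>m\<in>compositions k n. chi_square k n p0 m \<le> B * ln n \<longrightarrow>
    (\<forall>p\<in>prob_simplex k. (\<forall>j\<in>{1..<k}. \<bar>p j - real (m j) / real n\<bar> \<le> 1 / sqrt n) \<longrightarrow>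
      c * real n powr (- (real k - 1) / 2) \<le> multinomial_prob k n p m)"
proof -
  obtain \<delta> where \<delta>: "0 < \<delta>" "\<delta> \<le> 1" "\<And>j. j \<in> {1..k} \<Longrightarrow> \<delta> \<le> p0 j \<and> p0 j \<le> 1"
    using p0_bounds by auto
  have k1: "1 \<le> k" using k by simp
  define K where "K = real k"
  have K: "1 \<le> K" using k by (simp add: K_def)
  have ev1: "\<forall>\<^sub>F n in sequentially. 2 * K * (K * sqrt (real n)) ^ 3 / (real n * (\<delta>/2))\<^sup>2 \<le> 1"
    using \<delta>(1) K by real_asymp
  have ev2: "\<forall>\<^sub>F n in sequentially. K * sqrt (real n) \<le> real n * (\<delta> / 4)"
    using \<delta>(1) K by real_asymp
  have ev3: "\<forall>\<^sub>F n in sequentially. sqrt (real n * (B * ln n)) \<le> real n * (\<delta> / 4)"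
    using B \<delta>(1) by real_asymp
  let ?c = "exp (3/4 - real k) * exp (- (K ^ 3 / \<delta> + 1))"
  have "\<forall>\<^sub>F n in sequentially. \<forall>m\<in>compositions k n. chi_square k n p0 m \<le> B * ln n \<longrightarrow>
    (\<forall>p\<in>prob_simplex k. (\<forall>j\<in>{1..<k}. \<bar>p j - real (m j) / real n\<bar> \<le> 1 / sqrt n) \<longrightarrow>
      ?c * real n powr (- (real k - 1) / 2) \<le> multinomial_prob k n p m)"
    using ev1 ev2 ev3 eventually_ge_at_top[of 1]
  proof eventually_elim
    case (elim n)
    show ?case
    proof (intro ballI impI)
      fix m p assume m: "m \<in> compositions k n" and chi: "chi_square k n p0 m \<le> B * ln n"
        and p: "p \<in> prob_simplex k" and near: "\<forall>j\<in>{1..<k}. \<bar>p j - real (m j) / real n\<bar> \<le> 1 / sqrt n"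
      let ?r = "K * sqrt (real n)"
      have sq: "real n / sqrt n = sqrt n" using elim(4) by (simp add: real_div_sqrt)
      have dev0: "\<bar>real (m j) - real n * p j\<bar> \<le> sqrt (real n)" if j: "j \<in> {1..<k}" for j
      proof -
        have "\<bar>real (m j) - real n * p j\<bar> = real n * \<bar>p j - real (m j) / real n\<bar>"
          using elim(4) abs_mult[of "real n" "p j - real (m j) / real n"]
          by (simp add: ring_distribs abs_minus_commute)
        also have "\<dots> \<le> real n * (1 / sqrt n)" using near j by (intro mult_left_mono) auto
        finally show ?thesis using sq by simp
      qed
      have dev: "\<bar>real (m j) - real n * p j\<bar> \<le> ?r" if j: "j \<in> {1..k}" for j
      proof (cases "j = k")
        case False
        have "sqrt n \<le> ?r" using K mult_right_mono[of 1 K "sqrt n"] by simp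
        then show ?thesis using dev0[of j] j False by force
      next
        case True
        have "(\<Sum>j\<in>{1..k}. real (m j) - real n * p j) = 0"
          using m p by (simp add: sum_subtractf compositions_def prob_simplex_def flip: of_nat_sum sum_distrib_left)
        then have "real (m k) - real n * p k = - (\<Sum>j\<in>{1..<k}. real (m j) - real n * p j)"
          unfolding sum_split_last[OF k1] by simp
        then have "\<bar>real (m k) - real n * p k\<bar> \<le> (\<Sum>j\<in>{1..<k}. \<bar>real (m j) - real n * p j\<bar>)"
          by (simp only: abs_minus_cancel sum_abs)
        also have "\<dots> \<le> real (card {1..<k}) * sqrt n" using dev0 by (intro sum_bounded_above) auto
        also have "\<dots> \<le> ?r" by (intro mult_right_mono) (auto simp: K_def)
        finally show ?thesis using True by simp
      qed
      have mj: "0 < m j \<and> \<delta> / 4 * real n \<le> real (m j)" and pj: "\<delta> / 2 \<le> p j" if j: "j \<in> {1..k}" for j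
      proof -
        have n0: "real n * \<delta> \<le> real n * p0 j" using \<delta>(3)[OF j] by (simp add: mult_left_mono)
        have d1: "\<bar>real (m j) - real n * p0 j\<bar> \<le> sqrt (real n * (B * ln n))"
          by (rule chi_square_deviation[OF elim(4) j chi])
        have pos: "0 < real n * (\<delta> / 4)" using \<delta>(1) elim(4) by simp
        have "real n * (\<delta> / 4) \<le> real (m j)" "real n * (\<delta> / 2) \<le> real n * p j"
          using n0 d1 dev[OF j] elim(2,3) pos by (simp_all add: abs_le_iff)
        then show "0 < m j \<and> \<delta> / 4 * real n \<le> real (m j)" "\<delta> / 2 \<le> p j"
          using pos elim(4) by (auto simp: mult.commute)
      qed
      have "\<bar>scaled_entropy k n p m - chi_square k n p m / 2\<bar> \<le> 2 * real k * ?r ^ 3 / (real n * (\<delta>/2))\<^sup>2"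
        using \<delta> dev pj elim by (intro scaled_entropy_approx[OF elim(4) m p]) auto
      then have ent: "\<bar>scaled_entropy k n p m - chi_square k n p m / 2\<bar> \<le> 1"
        using elim(1) unfolding K_def by linarith
      have "chi_square k n p m \<le> (\<Sum>j\<in>{1..k}. K\<^sup>2 * 2 / \<delta>)"
        unfolding chi_square_def
      proof (intro sum_mono)
        fix j assume j: "j \<in> {1..k}"
        have "(real (m j) - real n * p j)\<^sup>2 \<le> ?r\<^sup>2"
          using dev[OF j] power_mono[of _ ?r 2] by (metis abs_ge_zero power2_abs)
        also have "?r\<^sup>2 = K\<^sup>2 * real n" by (simp add: power_mult_distrib)
        finally have "(real (m j) - real n * p j)\<^sup>2 / (real n * p j) \<le> K\<^sup>2 * real n / (real n * (\<delta>/2))"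
          using pj[OF j] \<delta>(1) elim(4) by (intro frac_le mult_left_mono) auto
        also have "\<dots> = K\<^sup>2 * 2 / \<delta>" using elim(4) by simp
        finally show "(real (m j) - real n * p j)\<^sup>2 / (real n * p j) \<le> K\<^sup>2 * 2 / \<delta>" .
      qed
      also have "\<dots> = 2 * (K ^ 3 / \<delta>)" by (simp add: K_def power2_eq_square power3_eq_cube)
      finally have "scaled_entropy k n p m \<le> K ^ 3 / \<delta> + 1" using ent by (simp add: abs_le_iff)
      then have "?c * real n powr (- (real k - 1) / 2)
          \<le> exp (3/4 - real k) * real n powr (- (real k - 1) / 2) * exp (- scaled_entropy k n p m)"
        by (simp add: mult_ac mult_right_mono)
      also have "\<dots> \<le> multinomial_prob k n p m"
      proof (rule multinomial_prob_bounds(1)[OF elim(4) _ m _ mj])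
        show "0 < p j" if "j \<in> {1..k}" for j using pj[OF that] \<delta>(1) by linarith
      qed (use \<delta>(1) k in auto)
      finally show "?c * real n powr (- (real k - 1) / 2) \<le> multinomial_prob k n p m" .
    qed
  qed
  then show ?thesis by (intro exI[of _ ?c]) auto
qed

text \<open>The last count is determined by the others, and the first \<open>k - 1\<close> range over intervals of length
  \<open>O(sqrt (n ln n))\<close>.\<close>
lemma chi_square_ball_count:
  assumes B: "0 < B"
  shows "\<exists>C>0. \<forall>\<^sub>F n in sequentially.
    real (card {m \<in> compositions k n. chi_square k n p0 m \<le> B * ln n})
      \<le> C * (real n * ln n) powr ((real k - 1) / 2)"
proof -
  have ev: "\<forall>\<^sub>F n in sequentially. 1 \<le> sqrt (real n * (B * ln n))" using B by real_asymp
  have ev2: "\<forall>\<^sub>F n in sequentially. 0 < ln (real n)" by real_asymp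
  let ?C = "(3 * sqrt B) ^ (k - 1)"
  have "\<forall>\<^sub>F n in sequentially. real (card {m \<in> compositions k n. chi_square k n p0 m \<le> B * ln n})
      \<le> ?C * (real n * ln n) powr ((real k - 1) / 2)"
    using ev ev2 eventually_ge_at_top[of 1]
  proof eventually_elim
    case (elim n)
    let ?M = "{m \<in> compositions k n. chi_square k n p0 m \<le> B * ln n}"
    let ?s = "sqrt (real n * (B * ln n))"
    let ?I = "\<lambda>j. {i :: nat. real n * p0 j - ?s \<le> real i \<and> real i \<le> real n * p0 j + ?s}"
    have inj: "inj_on (\<lambda>m. restrict m {1..<k}) ?M"
    proof (rule inj_onI)
      fix m m' assume *: "m \<in> ?M" "m' \<in> ?M" "restrict m {1..<k} = restrict m' {1..<k}"
      have eq: "m j = m' j" if "j \<in> {1..<k}" for j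
        using fun_cong[OF *(3), of j] that by simp
      have split: "sum m {1..k} = sum m {1..<k} + m k" for m :: "nat \<Rightarrow> nat"
        using k by (intro sum_split_last) simp
      have "sum m {1..<k} = sum m' {1..<k}" using eq by (intro sum.cong) auto
      moreover have "sum m {1..k} = sum m' {1..k}" using * by (simp add: compositions_def)
      ultimately have "m k = m' k" unfolding split by simp
      with eq have "m j = m' j" if "j \<in> {1..k}" for j using that by (cases "j = k") auto
      then show "m = m'" using *(1,2) by (auto simp: compositions_def intro: extensionalityI)
    qed
    have fin: "finite (?I j)" for j using elim(1) by (intro nat_interval_count_upper) auto
    have "card ?M \<le> card (PiE {1..<k} ?I)"
    proof (rule card_inj_on_le[OF inj])
      show "(\<lambda>m. restrict m {1..<k}) ` ?M \<subseteq> PiE {1..<k} ?I"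
      proof (rule image_subsetI)
        fix m assume "m \<in> ?M"
        then have m: "chi_square k n p0 m \<le> B * ln n" by simp
        have "m j \<in> ?I j" if "j \<in> {1..<k}" for j
          using chi_square_deviation[OF elim(3) _ m, of j] that by (auto simp: abs_le_iff)
        then show "restrict m {1..<k} \<in> PiE {1..<k} ?I" by auto
      qed
      show "finite (PiE {1..<k} ?I)" using fin by (intro finite_PiE) auto
    qed
    then have "real (card ?M) \<le> real (card (PiE {1..<k} ?I))" by (rule of_nat_mono)
    also have "\<dots> = (\<Prod>j\<in>{1..<k}. real (card (?I j)))" by (simp add: card_PiE)
    also have "\<dots> \<le> (\<Prod>j\<in>{1..<k}. 3 * ?s)"
    proof (intro prod_mono conjI)
      fix j
      have "real (card (?I j)) \<le> (real n * p0 j + ?s) - (real n * p0 j - ?s) + 1"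
        using elim(1) by (intro nat_interval_count_upper) auto
      then show "real (card (?I j)) \<le> 3 * ?s" using elim(1) by linarith
    qed auto
    also have "3 * ?s = 3 * sqrt B * sqrt (real n * ln n)" by (simp add: real_sqrt_mult)
    also have "(\<Prod>j\<in>{1..<k}. 3 * sqrt B * sqrt (real n * ln n))
        = (3 * sqrt B) ^ (k - 1) * (sqrt (real n * ln n)) ^ (k - 1)"
      by (simp only: prod_constant power_mult_distrib card_atLeastLessThan)
    also have "(sqrt (real n * ln n)) ^ (k - 1) = (real n * ln n) powr ((real k - 1) / 2)"
      using elim k by (simp add: sqrt_power_eq_powr)
    finally show ?case .
  qed
  then show ?thesis using B by (intro exI[of _ ?C]) auto
qed

text \<open>Displace the mean \<open>n p0\<close> by \<open>t\<close> in category \<open>1\<close> and by \<open>- t\<close> in category \<open>2\<close>, where \<open>t\<close> is chosen to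
  make chi-square equal to \<open>x + 1/2\<close>. Since \<open>t = O(sqrt (n ln n))\<close>, a further displacement of size
  \<open>r = \<eta> sqrt (n / ln n)\<close> changes chi-square by \<open>O((t r + r\<^sup>2) / n) = O(\<eta>)\<close>. For small \<open>\<eta>\<close> the whole cube of
  half-side \<open>r\<close> about the displaced point therefore stays in the shell, and it contains at least
  \<open>r ^ (k - 1)\<close> lattice points.\<close>
lemma chi_square_shell_count:
  assumes B: "0 < B"
  shows "\<exists>c>0. \<forall>\<^sub>F n in sequentially. \<forall>x. 0 \<le> x \<and> x \<le> B * ln n \<longrightarrow>
    c * (real n / ln n) powr ((real k - 1) / 2)
      \<le> real (card {m \<in> compositions k n. x < chi_square k n p0 m \<and> chi_square k n p0 m \<le> x + 1})"
proof -
  obtain \<delta> where \<delta>: "0 < \<delta>" "\<delta> \<le> 1" "\<And>j. j \<in> {1..k} \<Longrightarrow> \<delta> \<le> p0 j \<and> p0 j \<le> 1"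
    using p0_bounds by auto
  define K where "K = real k"
  have K: "1 \<le> K" using k by (simp add: K_def)
  \<comment> \<open>With \<open>\<eta> = 1 / H\<close> each of the \<open>k\<close> terms of chi-square changes by at most \<open>1 / (4 k)\<close>.\<close>
  define H where "H = 4 * K ^ 3 * (2 * sqrt (B + 1) + 1) / \<delta>"
  have sB: "0 \<le> sqrt (B + 1)" using B by simp
  have H1: "1 \<le> H"
  proof -
    have "1 \<le> 4 * K ^ 3" using one_le_power[OF K, of 3] by linarith
    then have "1 * 1 \<le> 4 * K ^ 3 * (2 * sqrt (B + 1) + 1)" using sB K by (intro mult_mono) auto
    then show ?thesis unfolding H_def using \<delta> by (simp add: le_divide_eq)
  qed
  define \<eta> where "\<eta> = 1 / H"
  have \<eta>: "0 < \<eta>" "\<eta> \<le> 1" using H1 by (auto simp: \<eta>_def)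
  define w where "w = 1 / p0 1 + 1 / p0 2"
  have p12: "0 < p0 1" "p0 1 \<le> 1" "0 < p0 2" "p0 2 \<le> 1" using \<delta>(1) \<delta>(3)[of 1] \<delta>(3)[of 2] k by auto
  have w: "1 \<le> w" unfolding w_def using p12 by (simp add: add_increasing2)
  have ev1: "\<forall>\<^sub>F n in sequentially. 1 \<le> ln (real n)" by real_asymp
  have ev2: "\<forall>\<^sub>F n in sequentially. 1 \<le> \<eta> * sqrt (real n / ln n)" using \<eta> by real_asymp
  have ev3: "\<forall>\<^sub>F n in sequentially.
      K * (\<eta> * sqrt (real n / ln n)) + sqrt (real n * ((B + 1) * ln n)) \<le> real n * \<delta>"
    using \<eta> \<delta>(1) B K by real_asymp
  have "\<forall>\<^sub>F n in sequentially. \<forall>x. 0 \<le> x \<and> x \<le> B * ln n \<longrightarrow>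
    \<eta> ^ (k - 1) * (real n / ln n) powr ((real k - 1) / 2)
      \<le> real (card {m \<in> compositions k n. x < chi_square k n p0 m \<and> chi_square k n p0 m \<le> x + 1})"
    using ev1 ev2 ev3 eventually_ge_at_top[of 1]
  proof eventually_elim
    case (elim n)
    define r where "r = \<eta> * sqrt (real n / ln n)"
    have r1: "1 \<le> r" using elim(2) by (simp add: r_def)
    show ?case
    proof (intro allI impI)
      fix x assume x: "0 \<le> x \<and> x \<le> B * ln n"
      define t where "t = sqrt (real n * (x + 1/2) / w)"
      define u where "u j = (if j = 1 then t else if j = (2::nat) then - t else 0)" for j
      define z where "z j = real n * p0 j + u j" for j
      let ?I = "\<lambda>j. {i :: nat. z j - r \<le> real i \<and> real i \<le> z j + r}"
      let ?T = "{m \<in> compositions k n. x < chi_square k n p0 m \<and> chi_square k n p0 m \<le> x + 1}"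
      have t0: "0 \<le> t" unfolding t_def using x w by (intro real_sqrt_ge_zero divide_nonneg_nonneg mult_nonneg_nonneg) auto
      have "t \<le> sqrt (real n * ((B + 1) * ln n))"
      proof -
        have "x + 1/2 \<le> (B + 1) * ln n" using x elim(1) by (simp add: ring_distribs)
        then have "real n * (x + 1/2) \<le> real n * ((B + 1) * ln n)" by (intro mult_left_mono) auto
        moreover have "real n * (x + 1/2) / w \<le> real n * (x + 1/2)"
          using w x mult_left_mono[of 1 w "real n * (x + 1/2)"] by (simp add: divide_le_eq)
        ultimately show ?thesis unfolding t_def by (intro real_sqrt_le_mono) linarith
      qed
      note t_le = this
      have u_le: "\<bar>u j\<bar> \<le> t" for j using t0 by (simp add: u_def)
      have npd: "real n * \<delta> \<le> real n * p0 j" if "j \<in> {1..k}" for j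
        using \<delta>(3)[OF that] by (intro mult_left_mono) auto
      have Kr: "r \<le> K * r" using K r1 by simp
      have z_ge: "K * r \<le> z j" if "j \<in> {1..k}" for j
        using npd[OF that] u_le[of j] t_le elim(3) unfolding z_def r_def[symmetric] by linarith
      have sum_u: "(\<Sum>j\<in>{1..k}. u j) = 0"
      proof -
        have "(\<Sum>j\<in>{1..k}. u j) = (\<Sum>j\<in>{1,2}. u j)"
          using k by (intro sum.mono_neutral_right) (auto simp: u_def)
        then show ?thesis by (simp add: u_def)
      qed
      have split: "sum f {1..k} = sum f {1..<k} + f k" for f :: "nat \<Rightarrow> real"
        using k by (intro sum_split_last) simp
      have sum_z: "(\<Sum>j\<in>{1..<k}. z j) + z k = real n"
      proof -
        have "(\<Sum>j\<in>{1..k}. z j) = real n * (\<Sum>j\<in>{1..k}. p0 j)"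
          unfolding z_def sum.distrib sum_u by (simp add: sum_distrib_left)
        then show ?thesis using p0(1) unfolding split[symmetric] by (simp add: prob_simplex_def)
      qed
      have chi_u: "(\<Sum>j\<in>{1..k}. (u j)\<^sup>2 / (real n * p0 j)) = x + 1/2"
      proof -
        have "(\<Sum>j\<in>{1..k}. (u j)\<^sup>2 / (real n * p0 j)) = (\<Sum>j\<in>{1,2}. (u j)\<^sup>2 / (real n * p0 j))"
          using k by (intro sum.mono_neutral_right) (auto simp: u_def)
        also have "\<dots> = t\<^sup>2 / n * w" by (simp add: u_def w_def ring_distribs)
        also have "t\<^sup>2 = real n * (x + 1/2) / w" unfolding t_def using x w by simp
        finally show ?thesis using w elim(4) by simp
      qed
      have mem: "complete_counts k n y \<in> ?T" if y: "y \<in> PiE {1..<k} ?I" for y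
      proof -
        let ?m = "complete_counts k n y"
        have dy: "\<bar>real (y j) - z j\<bar> \<le> r" if "j \<in> {1..<k}" for j
          using PiE_mem[OF y that] by (auto simp: abs_le_iff)
        have dsum: "\<bar>(\<Sum>j\<in>{1..<k}. real (y j)) - (\<Sum>j\<in>{1..<k}. z j)\<bar> \<le> K * r"
        proof -
          have "\<bar>(\<Sum>j\<in>{1..<k}. real (y j)) - (\<Sum>j\<in>{1..<k}. z j)\<bar> \<le> (\<Sum>j\<in>{1..<k}. \<bar>real (y j) - z j\<bar>)"
            unfolding sum_subtractf[symmetric] by (rule sum_abs)
          also have "\<dots> \<le> real (card {1..<k}) * r" using dy by (intro sum_bounded_above) auto
          also have "\<dots> \<le> K * r" using r1 by (intro mult_right_mono) (auto simp: K_def)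
          finally show ?thesis .
        qed
        have "(\<Sum>j\<in>{1..<k}. real (y j)) \<le> real n"
          using dsum sum_z z_ge[of k] k by auto
        then have sle: "(\<Sum>j\<in>{1..<k}. y j) \<le> n" by (simp flip: of_nat_sum)
        have comp: "?m \<in> compositions k n" using sle k by (intro complete_counts_in_compositions) auto
        define e where "e j = real (?m j) - z j" for j
        have e: "\<bar>e j\<bar> \<le> K * r" if j: "j \<in> {1..k}" for j
        proof (cases "j = k")
          case True
          have "real (?m k) = real n - (\<Sum>j\<in>{1..<k}. real (y j))"
            using sle k by (simp add: complete_counts_def of_nat_diff)
          then have "e k = (\<Sum>j\<in>{1..<k}. z j) - (\<Sum>j\<in>{1..<k}. real (y j))"
            using sum_z by (simp add: e_def)
          then show ?thesis using dsum True by (simp add: abs_minus_commute)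
        next
          case False
          then show ?thesis using dy[of j] j Kr by (simp add: e_def complete_counts_def)
        qed
        have term_bound: "\<bar>(2 * u j * e j + (e j)\<^sup>2) / (real n * p0 j)\<bar> \<le> 1 / (4 * K)" if j: "j \<in> {1..k}" for j
        proof -
          have "\<bar>2 * u j * e j + (e j)\<^sup>2\<bar> \<le> 2 * \<bar>u j\<bar> * \<bar>e j\<bar> + \<bar>e j\<bar>\<^sup>2"
            by (rule order_trans[OF abs_triangle_ineq]) (simp add: abs_mult)
          also have "\<dots> \<le> 2 * t * (K * r) + (K * r)\<^sup>2"
            using u_le[of j] e[OF j] t0 by (intro add_mono mult_mono power_mono) auto
          also have "\<dots> \<le> K\<^sup>2 * (2 * (t * r) + r\<^sup>2)"
          proof -
            have "2 * t * (K * r) \<le> K\<^sup>2 * (2 * (t * r))"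
              using K t0 r1 mult_right_mono[of K "K\<^sup>2" "2 * (t * r)"]
              by (simp add: power2_eq_square mult_ac)
            then show ?thesis by (simp add: power_mult_distrib ring_distribs)
          qed
          also have "\<dots> \<le> K\<^sup>2 * (\<eta> * real n * (2 * sqrt (B + 1) + 1))"
          proof (intro mult_left_mono)
            have "t * r \<le> sqrt (real n * ((B + 1) * ln n)) * r"
              using t_le r1 by (intro mult_right_mono) auto
            also have "\<dots> = \<eta> * (sqrt (real n * ((B + 1) * ln n)) * sqrt (real n / ln n))"
              by (simp add: r_def)
            also have "sqrt (real n * ((B + 1) * ln n)) * sqrt (real n / ln n) = real n * sqrt (B + 1)"
              using elim(1) by (simp add: real_sqrt_mult real_sqrt_divide)
            finally have 1: "t * r \<le> \<eta> * real n * sqrt (B + 1)" by simp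
            have "r\<^sup>2 = \<eta> * \<eta> * (real n / ln n)"
              using elim(1) by (simp add: r_def power_mult_distrib) (simp add: power2_eq_square)
            also have "\<dots> \<le> \<eta> * 1 * real n"
              using elim(1) \<eta> by (intro mult_mono) (auto simp: divide_le_eq mult_le_cancel_left1)
            finally show "2 * (t * r) + r\<^sup>2 \<le> \<eta> * real n * (2 * sqrt (B + 1) + 1)"
              using 1 by (simp add: ring_distribs)
          qed auto
          also have "\<dots> = real n * \<delta> / (4 * K)"
            unfolding \<eta>_def H_def using K \<delta>(1) sB
            by (simp add: field_simps power2_eq_square power3_eq_cube add_nonneg_eq_0_iff)
          finally have num: "\<bar>2 * u j * e j + (e j)\<^sup>2\<bar> \<le> real n * \<delta> / (4 * K)" .
          have "\<bar>(2 * u j * e j + (e j)\<^sup>2) / (real n * p0 j)\<bar> = \<bar>2 * u j * e j + (e j)\<^sup>2\<bar> / (real n * p0 j)"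
            using p0(2) j elim(4) by (simp add: abs_mult less_imp_le)
          also have "\<dots> \<le> (real n * \<delta> / (4 * K)) / (real n * \<delta>)"
            using num npd[OF j] elim(4) \<delta>(1) K by (intro frac_le) auto
          also have "\<dots> = 1 / (4 * K)" using elim(4) \<delta>(1) by simp
          finally show ?thesis .
        qed
        have "chi_square k n p0 ?m = (\<Sum>j\<in>{1..k}. (u j + e j)\<^sup>2 / (real n * p0 j))"
          unfolding chi_square_def by (intro sum.cong refl) (simp add: e_def z_def)
        also have "\<dots> = (\<Sum>j\<in>{1..k}. (u j)\<^sup>2 / (real n * p0 j))
            + (\<Sum>j\<in>{1..k}. (2 * u j * e j + (e j)\<^sup>2) / (real n * p0 j))"
          unfolding sum.distrib[symmetric]
          by (intro sum.cong refl) (simp add: power2_sum add_divide_distrib algebra_simps)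
        finally have chi: "chi_square k n p0 ?m - (x + 1/2)
            = (\<Sum>j\<in>{1..k}. (2 * u j * e j + (e j)\<^sup>2) / (real n * p0 j))"
          unfolding chi_u by simp
        have "\<bar>chi_square k n p0 ?m - (x + 1/2)\<bar>
            \<le> (\<Sum>j\<in>{1..k}. \<bar>(2 * u j * e j + (e j)\<^sup>2) / (real n * p0 j)\<bar>)"
          unfolding chi by (rule sum_abs)
        also have "\<dots> \<le> real (card {1..k}) * (1 / (4 * K))"
          using term_bound by (intro sum_bounded_above) auto
        also have "\<dots> = 1/4" using K by (simp add: K_def)
        finally have "\<bar>chi_square k n p0 ?m - (x + 1/2)\<bar> \<le> 1/4" .
        from abs_le_D1[OF this] abs_le_D2[OF this] show ?thesis using comp by simp
      qed
      have cnt: "finite (?I j) \<and> r \<le> real (card (?I j))" if j: "j \<in> {1..<k}" for j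
      proof -
        have "0 \<le> z j - r" using z_ge[of j] Kr j by auto
        moreover have "z j - r \<le> z j + r" using r1 by simp
        ultimately show ?thesis using nat_interval_count[of "z j - r" "z j + r"] r1 by auto
      qed
      have nln: "0 < real n / ln (real n)" using elim(1,4) by (intro divide_pos_pos) linarith+
      have "\<eta> ^ (k - 1) * (real n / ln n) powr ((real k - 1) / 2) = r ^ (k - 1)"
        unfolding r_def power_mult_distrib using elim k
        by (subst sqrt_power_eq_powr[OF nln, symmetric]) auto
      also have "\<dots> = (\<Prod>j\<in>{1..<k}. r)" by simp
      also have "\<dots> \<le> (\<Prod>j\<in>{1..<k}. real (card (?I j)))"
        using cnt r1 by (intro prod_mono) auto
      also have "\<dots> = real (card (PiE {1..<k} ?I))" by (simp add: card_PiE)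
      also have "\<dots> \<le> real (card ?T)"
        unfolding of_nat_le_iff
        by (rule card_inj_on_le[OF inj_on_complete_counts[of k n ?I]]) (use mem in auto)
      finally show "\<eta> ^ (k - 1) * (real n / ln n) powr ((real k - 1) / 2) \<le> real (card ?T)" .
    qed
  qed
  then show ?thesis using \<eta>(1) by (intro exI[of _ "\<eta> ^ (k - 1)"]) auto
qed

section \<open>The Type I error\<close>
lemma type1_prob_eq_sum:
  "type1_prob k n p0 x = (\<Sum>m | m \<in> compositions k n \<and> x < chi_square k n p0 m. multinomial_prob k n p0 m)"
  unfolding type1_prob_def pearson_eq_chi_square by (rule prob_cell_counts[OF p0(1)])

text \<open>The shell \<open>x < chi_square \<le> x + 1\<close> alone has \<open>(n / ln n) powr ((k - 1) / 2)\<close> lattice points, each of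
  probability of order \<open>n powr (- (k - 1) / 2) exp (- x / 2)\<close>.\<close>
lemma type1_prob_lower:
  assumes B: "0 < B"
  shows "\<exists>c>0. \<forall>\<^sub>F n in sequentially. \<forall>x. 0 \<le> x \<and> x \<le> B * ln n \<longrightarrow>
    c * ln n powr (- (real k - 1) / 2) * exp (- x / 2) \<le> type1_prob k n p0 x"
proof -
  have B1: "0 < B + 1" using B by simp
  from multinomial_prob_gaussian[OF B1] obtain c1 C1 where c1: "0 < c1"
    and ev1: "\<forall>\<^sub>F n in sequentially. \<forall>m\<in>compositions k n. chi_square k n p0 m \<le> (B + 1) * ln n \<longrightarrow>
      c1 * real n powr (- (real k - 1) / 2) * exp (- chi_square k n p0 m / 2) \<le> multinomial_prob k n p0 m \<and>
      multinomial_prob k n p0 m \<le> C1 * real n powr (- (real k - 1) / 2) * exp (- chi_square k n p0 m / 2)"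
    by blast
  from chi_square_shell_count[OF B] obtain c2 where c2: "0 < c2"
    and ev2: "\<forall>\<^sub>F n in sequentially. \<forall>x. 0 \<le> x \<and> x \<le> B * ln n \<longrightarrow>
      c2 * (real n / ln n) powr ((real k - 1) / 2)
        \<le> real (card {m \<in> compositions k n. x < chi_square k n p0 m \<and> chi_square k n p0 m \<le> x + 1})"
    by auto
  have ev3: "\<forall>\<^sub>F n in sequentially. 1 \<le> ln (real n)" by real_asymp
  let ?c = "c2 * c1 * exp (-1/2)"
  have "\<forall>\<^sub>F n in sequentially. \<forall>x. 0 \<le> x \<and> x \<le> B * ln n \<longrightarrow>
    ?c * ln n powr (- (real k - 1) / 2) * exp (- x / 2) \<le> type1_prob k n p0 x"
    using ev1 ev2 ev3 eventually_ge_at_top[of 1]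
  proof eventually_elim
    case (elim n)
    show ?case
    proof (intro allI impI)
      fix x assume x: "0 \<le> x \<and> x \<le> B * ln n"
      let ?e = "(real k - 1) / 2"
      let ?T = "{m \<in> compositions k n. x < chi_square k n p0 m \<and> chi_square k n p0 m \<le> x + 1}"
      let ?b = "c1 * real n powr (- ?e) * exp (- (x + 1) / 2)"
      have "real n powr ?e * real n powr (- ?e) = 1"
        using elim(4) by (simp flip: powr_add)
      moreover have "(real n / ln n) powr ?e = real n powr ?e * ln n powr (- ?e)"
        using elim(3) by (simp add: powr_divide powr_minus divide_simps)
      moreover have "exp (- (x + 1) / 2) = exp (-1/2) * exp (- x / 2)"
        by (simp add: exp_add[symmetric] add_divide_distrib diff_divide_distrib)
      ultimately have "?c * ln n powr (- ?e) * exp (- x / 2) = c2 * (real n / ln n) powr ?e * ?b"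
        by (simp add: mult_ac)
      also have "\<dots> \<le> real (card ?T) * ?b"
        using elim(2) x c1 by (intro mult_right_mono) auto
      also have "\<dots> = (\<Sum>m\<in>?T. ?b)" by simp
      also have "\<dots> \<le> (\<Sum>m\<in>?T. multinomial_prob k n p0 m)"
      proof (intro sum_mono)
        fix m assume m: "m \<in> ?T"
        have "x + 1 \<le> (B + 1) * ln n" using x elim(3) by (simp add: ring_distribs)
        then have "c1 * real n powr (- (real k - 1) / 2) * exp (- chi_square k n p0 m / 2) \<le> multinomial_prob k n p0 m"
          using elim(1) m by auto
        moreover have "?b \<le> c1 * real n powr (- (real k - 1) / 2) * exp (- chi_square k n p0 m / 2)"
          unfolding minus_divide_left using m c1 by (intro mult_mono) auto
        ultimately show "?b \<le> multinomial_prob k n p0 m" by linarith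
      qed
      also have "\<dots> \<le> type1_prob k n p0 x"
        unfolding type1_prob_eq_sum
        by (intro sum_mono2) (auto intro: multinomial_prob_nonneg[OF p0(1)])
      finally show "?c * ln n powr (- (real k - 1) / 2) * exp (- x / 2) \<le> type1_prob k n p0 x"
        unfolding minus_divide_left .
    qed
  qed
  then show ?thesis using c1 c2 by (intro exI[of _ ?c]) auto
qed

text \<open>If no category count deviates by more than \<open>sqrt (n \<delta> s / k)\<close>, then every term of Pearson's
  statistic is at most \<open>s / k\<close>; the union bound does the rest.\<close>
lemma type1_prob_tail:
  assumes n: "1 \<le> n" and s: "0 \<le> s" and \<delta>: "0 < \<delta>" "\<And>j. j \<in> {1..k} \<Longrightarrow> \<delta> \<le> p0 j"
  shows "type1_prob k n p0 s \<le> 2 * real k * exp (- 2 * \<delta> * s / real k)"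
proof -
  let ?t = "sqrt (real n * \<delta> * s / real k)"
  let ?P = "measure_pmf.prob (iid_sample k n p0)"
  have t2: "?t\<^sup>2 = real n * \<delta> * s / real k" using \<delta>(1) s by simp
  have sub: "{X. s < pearson k n p0 X}
      \<subseteq> (\<Union>j\<in>{1..k}. {X. ?t \<le> \<bar>real (category_count n X j) - real n * p0 j\<bar>})"
  proof
    fix X assume "X \<in> {X. s < pearson k n p0 X}"
    then have X: "s < pearson k n p0 X" by simp
    show "X \<in> (\<Union>j\<in>{1..k}. {X. ?t \<le> \<bar>real (category_count n X j) - real n * p0 j\<bar>})"
    proof (rule ccontr)
      assume "\<not> ?thesis"
      then have small: "\<bar>real (category_count n X j) - real n * p0 j\<bar> \<le> ?t" if "j \<in> {1..k}" for j
        using that by force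
      have "pearson k n p0 X \<le> (\<Sum>j\<in>{1..k}. s / real k)"
        unfolding pearson_def
      proof (intro sum_mono)
        fix j assume j: "j \<in> {1..k}"
        have "(real (category_count n X j) - real n * p0 j)\<^sup>2 \<le> ?t\<^sup>2"
          using small[OF j] power_mono[of _ ?t 2] by (metis abs_ge_zero power2_abs)
        then have "(real (category_count n X j) - real n * p0 j)\<^sup>2 / (real n * p0 j)
            \<le> (real n * \<delta> * s / real k) / (real n * \<delta>)"
          unfolding t2 using \<delta>(1) \<delta>(2)[OF j] n s by (intro frac_le mult_left_mono) auto
        also have "\<dots> = s / real k" using \<delta>(1) n by simp
        finally show "(real (category_count n X j) - real n * p0 j)\<^sup>2 / (real n * p0 j) \<le> s / real k" .
      qed
      also have "\<dots> = s" using k by simp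
      finally show False using X by simp
    qed
  qed
  have "type1_prob k n p0 s \<le> ?P (\<Union>j\<in>{1..k}. {X. ?t \<le> \<bar>real (category_count n X j) - real n * p0 j\<bar>})"
    unfolding type1_prob_def using sub by (intro measure_pmf.finite_measure_mono) auto
  also have "\<dots> \<le> (\<Sum>j\<in>{1..k}. ?P {X. ?t \<le> \<bar>real (category_count n X j) - real n * p0 j\<bar>})"
    by (intro measure_pmf.finite_measure_subadditive_finite) auto
  also have "\<dots> \<le> (\<Sum>j\<in>{1..k}. 2 * exp (- 2 * ?t\<^sup>2 / real n))"
    using n s \<delta>(1) by (intro sum_mono prob_category_count_deviation[OF p0(1)]) auto
  also have "\<dots> = 2 * real k * exp (- 2 * \<delta> * s / real k)"
    unfolding t2 using n by simp
  finally show ?thesis .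
qed

text \<open>Up to a level \<open>D ln n\<close> the lattice points are counted and their Gaussian weights bounded by the
  weight at level \<open>x\<close>; beyond it the crude tail bound suffices, because \<open>D\<close> can be taken large.\<close>
lemma type1_prob_upper:
  assumes B: "0 < B"
  shows "\<exists>C>0. \<forall>\<^sub>F n in sequentially. \<forall>x. 0 \<le> x \<and> x \<le> B * ln n \<longrightarrow>
    type1_prob k n p0 x \<le> C * ln n powr ((real k - 1) / 2) * exp (- x / 2)"
proof -
  obtain \<delta> where \<delta>: "0 < \<delta>" "\<delta> \<le> 1" "\<And>j. j \<in> {1..k} \<Longrightarrow> \<delta> \<le> p0 j \<and> p0 j \<le> 1"
    using p0_bounds by auto
  \<comment> \<open>This \<open>D\<close> turns the tail bound at level \<open>D ln n\<close> into \<open>2 k exp (- 2 B ln n)\<close>, which is below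
      \<open>2 k exp (- x / 2)\<close> for all \<open>x \<le> B ln n\<close>.\<close>
  define D where "D = real k * B / \<delta>"
  have D: "0 < D" using B \<delta> k by (simp add: D_def)
  from multinomial_prob_gaussian[OF D] obtain c1 C1 where C1: "0 < C1"
    and ev1: "\<forall>\<^sub>F n in sequentially. \<forall>m\<in>compositions k n. chi_square k n p0 m \<le> D * ln n \<longrightarrow>
      c1 * real n powr (- (real k - 1) / 2) * exp (- chi_square k n p0 m / 2) \<le> multinomial_prob k n p0 m \<and>
      multinomial_prob k n p0 m \<le> C1 * real n powr (- (real k - 1) / 2) * exp (- chi_square k n p0 m / 2)"
    by blast
  from chi_square_ball_count[OF D] obtain C2 where C2: "0 < C2"
    and ev2: "\<forall>\<^sub>F n in sequentially. real (card {m \<in> compositions k n. chi_square k n p0 m \<le> D * ln n})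
      \<le> C2 * (real n * ln n) powr ((real k - 1) / 2)"
    by auto
  have ev3: "\<forall>\<^sub>F n in sequentially. 1 \<le> ln (real n)" by real_asymp
  let ?C = "C2 * C1 + 2 * real k"
  have "\<forall>\<^sub>F n in sequentially. \<forall>x. 0 \<le> x \<and> x \<le> B * ln n \<longrightarrow>
    type1_prob k n p0 x \<le> ?C * ln n powr ((real k - 1) / 2) * exp (- x / 2)"
    using ev1 ev2 ev3 eventually_ge_at_top[of 1]
  proof eventually_elim
    case (elim n)
    show ?case
    proof (intro allI impI)
      fix x assume x: "0 \<le> x \<and> x \<le> B * ln n"
      let ?e = "(real k - 1) / 2"
      let ?T = "{m \<in> compositions k n. chi_square k n p0 m \<le> D * ln n}"
      let ?b = "C1 * real n powr (- ?e) * exp (- x / 2)"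
      have "type1_prob k n p0 x
          \<le> (\<Sum>m | m \<in> compositions k n \<and> x < chi_square k n p0 m \<and> chi_square k n p0 m \<le> D * ln n. multinomial_prob k n p0 m)
            + (\<Sum>m | m \<in> compositions k n \<and> D * ln n < chi_square k n p0 m. multinomial_prob k n p0 m)"
        unfolding type1_prob_eq_sum
        by (subst sum.union_disjoint[symmetric])
           (auto intro!: sum_mono2 multinomial_prob_nonneg[OF p0(1)])
      also have "(\<Sum>m | m \<in> compositions k n \<and> D * ln n < chi_square k n p0 m. multinomial_prob k n p0 m)
          \<le> 2 * real k * exp (- 2 * \<delta> * (D * ln n) / real k)"
        unfolding type1_prob_eq_sum[symmetric] using D \<delta> elim by (intro type1_prob_tail) auto
      also have "- 2 * \<delta> * (D * ln n) / real k = - 2 * (B * ln n)"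
        using \<delta> k by (simp add: D_def)
      also have "2 * real k * exp (- 2 * (B * ln n)) \<le> 2 * real k * exp (- x / 2)"
        using x by (intro mult_left_mono) auto
      also have "(\<Sum>m | m \<in> compositions k n \<and> x < chi_square k n p0 m \<and> chi_square k n p0 m \<le> D * ln n. multinomial_prob k n p0 m)
          \<le> (\<Sum>m | m \<in> compositions k n \<and> x < chi_square k n p0 m \<and> chi_square k n p0 m \<le> D * ln n. ?b)"
      proof (intro sum_mono)
        fix m assume m: "m \<in> {m. m \<in> compositions k n \<and> x < chi_square k n p0 m \<and> chi_square k n p0 m \<le> D * ln n}"
        then have "multinomial_prob k n p0 m \<le> C1 * real n powr (- (real k - 1) / 2) * exp (- chi_square k n p0 m / 2)"
          using elim(1) by auto
        also have "\<dots> \<le> ?b"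
          unfolding minus_divide_left using m C1 by (intro mult_mono) auto
        finally show "multinomial_prob k n p0 m \<le> ?b" .
      qed
      also have "\<dots> \<le> (\<Sum>m\<in>?T. ?b)" using C1 by (intro sum_mono2) auto
      also have "\<dots> = real (card ?T) * ?b" by simp
      also have "\<dots> \<le> C2 * (real n * ln n) powr ?e * ?b"
        using elim(2) C1 by (intro mult_right_mono) auto
      also have "\<dots> = C2 * C1 * ln n powr ?e * exp (- x / 2)"
      proof -
        have "real n powr ?e * real n powr (- ?e) = 1"
          using elim(4) by (simp flip: powr_add)
        moreover have "(real n * ln n) powr ?e = real n powr ?e * ln n powr ?e"
          using elim(3) by (simp add: powr_mult)
        ultimately show ?thesis by (simp add: mult_ac)
      qed
      finally have "type1_prob k n p0 x \<le> C2 * C1 * ln n powr ?e * exp (- x / 2) + 2 * real k * exp (- x / 2)"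
        by simp
      also have "2 * real k * exp (- x / 2) \<le> 2 * real k * ln n powr ?e * exp (- x / 2)"
      proof -
        have "1 \<le> ln n powr ?e" using elim(3) k by (intro ge_one_powr_ge_zero) auto
        then have "2 * real k * 1 \<le> 2 * real k * ln n powr ?e" by (intro mult_left_mono) auto
        then show ?thesis by (intro mult_right_mono) auto
      qed
      finally show "type1_prob k n p0 x \<le> ?C * ln n powr ((real k - 1) / 2) * exp (- x / 2)"
        by (simp add: ring_distribs)
    qed
  qed
  then show ?thesis using C1 C2 by (intro exI[of _ ?C]) (auto simp: add_pos_nonneg)
qed

end

section \<open>The Dirichlet prior\<close>

text \<open>Extending the power by \<open>0\<close> to the whole line turns the Beta integral into a convolution identity
  that holds for every real \<open>t\<close>.\<close>
definition powr_plus :: "real \<Rightarrow> real \<Rightarrow> ennreal" where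
  "powr_plus a x = ennreal (if 0 < x then x powr (a - 1) else 0)"

lemma borel_measurable_powr_plus [measurable]: "powr_plus a \<in> borel_measurable borel"
  unfolding powr_plus_def by measurable

text \<open>For \<open>t > 0\<close> the substitution \<open>y = t u\<close> reduces the convolution to the Beta integral.\<close>
lemma convolution_powr_plus:
  assumes "0 < a" "0 < b"
  shows "(\<integral>\<^sup>+ y. powr_plus a y * powr_plus b (t - y) \<partial>lborel) = ennreal (Beta a b) * powr_plus (a + b) t"
proof (cases "0 < t")
  case False
  then have *: "powr_plus a y * powr_plus b (t - y) = 0" for y by (simp add: powr_plus_def)
  show ?thesis unfolding * using False by (simp add: powr_plus_def)
next
  case t: True
  have pt: "powr_plus a (0 + t * u) * powr_plus b (t - (0 + t * u)) =
      ennreal (t powr (a + b - 2)) * ennreal (u powr (a - 1) * (1 - u) powr (b - 1) * indicator {0..1} u)" for u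
  proof (cases "0 < u \<and> u < 1")
    case True
    have e: "t - t * u = t * (1 - u)" by (simp add: algebra_simps)
    have "(t * u) powr (a - 1) * (t * (1 - u)) powr (b - 1)
        = t powr (a + b - 2) * (u powr (a - 1) * (1 - u) powr (b - 1))"
      using t True by (simp add: powr_mult powr_diff powr_add divide_simps power2_eq_square)
    then show ?thesis using t True e
      by (simp add: powr_plus_def ennreal_mult[symmetric] zero_less_mult_iff)
  next
    case False
    then have "\<not> (0 < t * u \<and> 0 < t - t * u)" using t by (simp add: zero_less_mult_iff)
    then have 1: "powr_plus a (0 + t * u) * powr_plus b (t - (0 + t * u)) = 0"
      by (auto simp: powr_plus_def)
    have 2: "u powr (a - 1) * (1 - u) powr (b - 1) * indicator {0..1} u = 0"
      using False by (cases "u = 0 \<or> u = 1") (auto simp: indicator_def)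
    show ?thesis unfolding 1 2 by simp
  qed
  have hi: "((\<lambda>u. u powr (a - 1) * (1 - u) powr (b - 1)) has_integral Beta a b) {0..1}"
    by (rule has_integral_Beta_real[OF assms])
  have beta: "(\<integral>\<^sup>+ u. ennreal (u powr (a - 1) * (1 - u) powr (b - 1) * indicator {0..1} u) \<partial>lborel) = ennreal (Beta a b)"
    using nn_integral_has_integral_lebesgue[OF _ hi] by (simp add: mult_ac ennreal_mult' ennreal_indicator)
  have "(\<integral>\<^sup>+ y. powr_plus a y * powr_plus b (t - y) \<partial>lborel)
      = ennreal \<bar>t\<bar> * (\<integral>\<^sup>+ u. powr_plus a (0 + t * u) * powr_plus b (t - (0 + t * u)) \<partial>lborel)"
    using t by (intro nn_integral_real_affine) auto
  also have "\<dots> = ennreal t * (ennreal (t powr (a + b - 2)) * ennreal (Beta a b))"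
    unfolding pt using t by (subst nn_integral_cmult) (auto simp: beta)
  also have "\<dots> = ennreal (Beta a b) * (ennreal t * ennreal (t powr (a + b - 2)))"
    by (simp add: mult_ac)
  also have "ennreal t * ennreal (t powr (a + b - 2)) = powr_plus (a + b) t"
  proof -
    have "t * t powr (a + b - 2) = t powr (1 + (a + b - 2))"
      using t by (subst powr_add) simp
    then show ?thesis using t by (simp add: powr_plus_def ennreal_mult[symmetric])
  qed
  finally show ?thesis .
qed

text \<open>Integrating out the coordinate \<open>i\<close> is a convolution and turns the exponent \<open>b\<close> of the remaining mass
  into \<open>a i + b\<close>, which is why the induction runs over all \<open>b\<close>.\<close>
lemma dirichlet_integral_finite:
  assumes "finite A" "\<And>j. j \<in> A \<Longrightarrow> 0 < a j" "0 < b"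
  shows "(\<integral>\<^sup>+ y. (\<Prod>j\<in>A. powr_plus (a j) (y j)) * powr_plus b (1 - (\<Sum>j\<in>A. y j)) \<partial>PiM A (\<lambda>_. lborel)) < \<infinity>"
  using assms
proof (induction A arbitrary: b rule: finite_induct)
  interpret product_sigma_finite "\<lambda>_ :: 'a. lborel :: real measure" ..
  case empty
  show ?case by (simp add: PiM_empty powr_plus_def nn_integral_count_space_finite)
next
  interpret product_sigma_finite "\<lambda>_ :: 'a. lborel :: real measure" ..
  case (insert i A)
  have "(\<integral>\<^sup>+ y. (\<Prod>j\<in>insert i A. powr_plus (a j) (y j)) * powr_plus b (1 - (\<Sum>j\<in>insert i A. y j)) \<partial>PiM (insert i A) (\<lambda>_. lborel))
      = (\<integral>\<^sup>+ x. (\<integral>\<^sup>+ y. (\<Prod>j\<in>insert i A. powr_plus (a j) ((x(i := y)) j))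
          * powr_plus b (1 - (\<Sum>j\<in>insert i A. (x(i := y)) j)) \<partial>lborel) \<partial>PiM A (\<lambda>_. lborel))"
    using insert.hyps by (intro product_nn_integral_insert) auto
  also have "\<dots> = (\<integral>\<^sup>+ x. ennreal (Beta (a i) b) * ((\<Prod>j\<in>A. powr_plus (a j) (x j)) * powr_plus (a i + b) (1 - (\<Sum>j\<in>A. x j)))
      \<partial>PiM A (\<lambda>_. lborel))"
  proof (intro nn_integral_cong)
    fix x
    have 1: "(\<Prod>j\<in>A. powr_plus (a j) ((x(i := y)) j)) = (\<Prod>j\<in>A. powr_plus (a j) (x j))"
      "(\<Sum>j\<in>A. (x(i := y)) j) = (\<Sum>j\<in>A. x j)" for y
      using insert.hyps by (intro prod.cong sum.cong; auto)+
    have "(\<integral>\<^sup>+ y. (\<Prod>j\<in>insert i A. powr_plus (a j) ((x(i := y)) j))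
          * powr_plus b (1 - (\<Sum>j\<in>insert i A. (x(i := y)) j)) \<partial>lborel)
      = (\<integral>\<^sup>+ y. (\<Prod>j\<in>A. powr_plus (a j) (x j)) * (powr_plus (a i) y * powr_plus b ((1 - (\<Sum>j\<in>A. x j)) - y)) \<partial>lborel)"
      unfolding prod.insert[OF insert.hyps] sum.insert[OF insert.hyps] 1
      by (intro nn_integral_cong) (simp add: algebra_simps)
    also have "\<dots> = (\<Prod>j\<in>A. powr_plus (a j) (x j)) * (ennreal (Beta (a i) b) * powr_plus (a i + b) (1 - (\<Sum>j\<in>A. x j)))"
      using insert.prems by (subst nn_integral_cmult) (auto simp: convolution_powr_plus)
    finally show "(\<integral>\<^sup>+ y. (\<Prod>j\<in>insert i A. powr_plus (a j) ((x(i := y)) j))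
          * powr_plus b (1 - (\<Sum>j\<in>insert i A. (x(i := y)) j)) \<partial>lborel)
      = ennreal (Beta (a i) b) * ((\<Prod>j\<in>A. powr_plus (a j) (x j)) * powr_plus (a i + b) (1 - (\<Sum>j\<in>A. x j)))"
      by (simp add: mult_ac)
  qed
  also have "\<dots> = ennreal (Beta (a i) b) * (\<integral>\<^sup>+ x. (\<Prod>j\<in>A. powr_plus (a j) (x j)) * powr_plus (a i + b) (1 - (\<Sum>j\<in>A. x j))
      \<partial>PiM A (\<lambda>_. lborel))"
    using insert.hyps by (intro nn_integral_cmult) auto
  also have "\<dots> < \<infinity>"
    using insert.IH[of "a i + b"] insert.prems by (auto simp: ennreal_mult_less_top add_pos_pos)
  finally show ?case .
qed

lemma powr_bounds:
  fixes x h e :: real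
  assumes "0 < h" "h \<le> x" "x \<le> 1"
  shows "h powr \<bar>e\<bar> \<le> x powr e" "x powr e \<le> h powr (- \<bar>e\<bar>)"
proof -
  have "h powr \<bar>e\<bar> \<le> x powr \<bar>e\<bar>" using assms by (intro powr_mono2) auto
  also have "\<dots> \<le> x powr e" using assms by (intro powr_mono') auto
  finally show "h powr \<bar>e\<bar> \<le> x powr e" .
  have "x powr e \<le> x powr (- \<bar>e\<bar>)" using assms by (intro powr_mono') auto
  also have "\<dots> \<le> h powr (- \<bar>e\<bar>)" using assms by (intro powr_mono2') auto
  finally show "x powr e \<le> h powr (- \<bar>e\<bar>)" .
qed

lemma prob_simplex_le_1: "p \<in> prob_simplex k \<Longrightarrow> j \<in> {1..k} \<Longrightarrow> p j \<le> 1"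
  using member_le_sum[of j "{1..k}" p] by (auto simp: prob_simplex_def)

lemma measurable_simplex_point:
  "simplex_point k \<in> measurable (PiM {1..<k} (\<lambda>_. lborel)) (PiM {1..k} (\<lambda>_. borel))"
  unfolding simplex_point_def
proof (rule measurable_restrict)
  fix j assume "j \<in> {1..k}"
  show "(\<lambda>y. if j < k then y j else 1 - (\<Sum>i\<in>{1..<k}. y i)) \<in> borel_measurable (PiM {1..<k} (\<lambda>_. lborel))"
    using \<open>j \<in> {1..k}\<close> by (cases "j < k") (auto intro!: borel_measurable_diff borel_measurable_sum)
qed

lemma pred_prob_simplex: "Measurable.pred (PiM {1..k} (\<lambda>_. borel)) (\<lambda>p. p \<in> prob_simplex k)"
proof -
  have [measurable]: "(\<lambda>p. p j) \<in> borel_measurable (PiM {1..k} (\<lambda>_. borel :: real measure))" if "j \<in> {1..k}" for j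
    using that by measurable
  show ?thesis unfolding prob_simplex_def mem_Collect_eq by measurable
qed

lemma measurable_dirichlet_density:
  "dirichlet_density k a \<in> borel_measurable (PiM {1..k} (\<lambda>_. borel))"
proof -
  have [measurable]: "(\<lambda>p. p j) \<in> borel_measurable (PiM {1..k} (\<lambda>_. borel :: real measure))" if "j \<in> {1..k}" for j
    using that by measurable
  note pred_prob_simplex[measurable]
  show ?thesis unfolding dirichlet_density_def by measurable
qed

lemma space_dirichlet: "space (dirichlet k a) = space (PiM {1..k} (\<lambda>_. borel))"
  and sets_dirichlet [measurable_cong]: "sets (dirichlet k a) = sets (PiM {1..k} (\<lambda>_. borel))"
  by (simp_all add: dirichlet_def)

lemma emeasure_dirichlet:
  assumes A: "A \<in> sets (PiM {1..k} (\<lambda>_. borel))"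
  shows "emeasure (dirichlet k a) A =
    (\<integral>\<^sup>+ y. ennreal (dirichlet_density k a (simplex_point k y)) * indicator A (simplex_point k y) \<partial>PiM {1..<k} (\<lambda>_. lborel))"
proof -
  note measurable_simplex_point[measurable] measurable_dirichlet_density[measurable]
  have S: "simplex_point k -` A \<inter> space (PiM {1..<k} (\<lambda>_. lborel)) \<in> sets (PiM {1..<k} (\<lambda>_. lborel))"
    by (rule measurable_sets[OF measurable_simplex_point A])
  let ?D = "density (PiM {1..<k} (\<lambda>_. lborel)) (\<lambda>y. ennreal (dirichlet_density k a (simplex_point k y)))"
  have "emeasure (dirichlet k a) A = emeasure ?D (simplex_point k -` A \<inter> space ?D)"
    unfolding dirichlet_def using A measurable_simplex_point[of k] by (intro emeasure_distr) simp_all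
  also have "\<dots> = (\<integral>\<^sup>+ y. ennreal (dirichlet_density k a (simplex_point k y))
      * indicator (simplex_point k -` A \<inter> space ?D) y \<partial>PiM {1..<k} (\<lambda>_. lborel))"
    using S measurable_compose[OF measurable_simplex_point measurable_dirichlet_density]
    by (intro emeasure_density) auto
  also have "\<dots> = (\<integral>\<^sup>+ y. ennreal (dirichlet_density k a (simplex_point k y))
      * indicator A (simplex_point k y) \<partial>PiM {1..<k} (\<lambda>_. lborel))"
    by (intro nn_integral_cong) (auto simp: indicator_def)
  finally show ?thesis .
qed

lemma simplex_point_in_prob_simplex:
  assumes "1 \<le> k"
  shows "simplex_point k y \<in> prob_simplex k \<longleftrightarrow> (\<forall>j\<in>{1..<k}. 0 \<le> y j) \<and> (\<Sum>i\<in>{1..<k}. y i) \<le> 1"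
proof -
  have "(\<Sum>j\<in>{1..k}. simplex_point k y j) = (\<Sum>j\<in>{1..<k}. simplex_point k y j) + simplex_point k y k"
    by (rule sum_split_last[OF assms])
  also have "(\<Sum>j\<in>{1..<k}. simplex_point k y j) = (\<Sum>j\<in>{1..<k}. y j)"
    by (intro sum.cong) (auto simp: simplex_point_def)
  finally have "(\<Sum>j\<in>{1..k}. simplex_point k y j) = 1" using assms by (simp add: simplex_point_def)
  moreover have "{1..k} = insert k {1..<k}" using assms by auto
  ultimately show ?thesis by (auto simp: prob_simplex_def simplex_point_def)
qed

context
  fixes k :: nat and a :: "nat \<Rightarrow> real"
  assumes k: "2 \<le> k" and a: "\<forall>j\<in>{1..k}. 0 < a j"
begin

lemma dirichlet_density_eq:
  "\<exists>Z>0. \<forall>p. dirichlet_density k a p =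
    (if p \<in> prob_simplex k \<and> (\<forall>j\<in>{1..k}. 0 < p j) then Z * (\<Prod>j\<in>{1..k}. p j powr (a j - 1)) else 0)"
proof -
  have "0 < (\<Sum>j\<in>{1..k}. a j)" using a k by (intro sum_pos) auto
  then have "0 < Gamma (\<Sum>j\<in>{1..k}. a j) / (\<Prod>j\<in>{1..k}. Gamma (a j))"
    using a by (intro divide_pos_pos prod_pos ballI Gamma_real_pos) auto
  then show ?thesis unfolding dirichlet_density_def by blast
qed

lemma finite_measure_dirichlet: "finite_measure (dirichlet k a)"
proof (rule finite_measureI)
  obtain Z where Z: "0 < Z" and dens: "\<And>p. dirichlet_density k a p =
      (if p \<in> prob_simplex k \<and> (\<forall>j\<in>{1..k}. 0 < p j) then Z * (\<Prod>j\<in>{1..k}. p j powr (a j - 1)) else 0)"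
    using dirichlet_density_eq by blast
  have I: "{1..k} = insert k {1..<k}" using k by auto
  have le: "ennreal (dirichlet_density k a (simplex_point k y))
      \<le> ennreal Z * ((\<Prod>j\<in>{1..<k}. powr_plus (a j) (y j)) * powr_plus (a k) (1 - (\<Sum>j\<in>{1..<k}. y j)))" for y
  proof (cases "simplex_point k y \<in> prob_simplex k \<and> (\<forall>j\<in>{1..k}. 0 < simplex_point k y j)")
    case True
    then have pos: "0 < simplex_point k y j" if "j \<in> {1..k}" for j using that by blast
    have "dirichlet_density k a (simplex_point k y) = Z * (\<Prod>j\<in>{1..k}. simplex_point k y j powr (a j - 1))"
      unfolding dens using True by simp
    also have "ennreal \<dots> = ennreal Z * (\<Prod>j\<in>{1..k}. ennreal (simplex_point k y j powr (a j - 1)))"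
      using Z by (simp add: ennreal_mult prod_nonneg prod_ennreal)
    also have "(\<Prod>j\<in>{1..k}. ennreal (simplex_point k y j powr (a j - 1)))
        = (\<Prod>j\<in>{1..k}. powr_plus (a j) (simplex_point k y j))"
      using pos by (intro prod.cong) (auto simp: powr_plus_def)
    also have "(\<Prod>j\<in>{1..k}. powr_plus (a j) (simplex_point k y j))
        = powr_plus (a k) (simplex_point k y k) * (\<Prod>j\<in>{1..<k}. powr_plus (a j) (simplex_point k y j))"
      unfolding I by (subst prod.insert) auto
    also have "(\<Prod>j\<in>{1..<k}. powr_plus (a j) (simplex_point k y j)) = (\<Prod>j\<in>{1..<k}. powr_plus (a j) (y j))"
      by (intro prod.cong) (auto simp: simplex_point_def)
    also have "simplex_point k y k = 1 - (\<Sum>j\<in>{1..<k}. y j)" using k by (simp add: simplex_point_def)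
    finally show ?thesis by (simp add: mult_ac)
  next
    case False
    then have "dirichlet_density k a (simplex_point k y) = 0" unfolding dirichlet_density_def by auto
    then show ?thesis by simp
  qed
  have "emeasure (dirichlet k a) (space (dirichlet k a))
      \<le> (\<integral>\<^sup>+ y. ennreal Z * ((\<Prod>j\<in>{1..<k}. powr_plus (a j) (y j)) * powr_plus (a k) (1 - (\<Sum>j\<in>{1..<k}. y j)))
          \<partial>PiM {1..<k} (\<lambda>_. lborel))"
    unfolding space_dirichlet
    by (subst emeasure_dirichlet) (auto intro!: nn_integral_mono le[simplified] simp: indicator_def)
  also have "\<dots> = ennreal Z * (\<integral>\<^sup>+ y. (\<Prod>j\<in>{1..<k}. powr_plus (a j) (y j)) * powr_plus (a k) (1 - (\<Sum>j\<in>{1..<k}. y j))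
          \<partial>PiM {1..<k} (\<lambda>_. lborel))"
    by (intro nn_integral_cmult) auto
  also have "\<dots> < \<infinity>"
    using dirichlet_integral_finite[of "{1..<k}" a "a k"] a k by (auto simp: ennreal_mult_less_top)
  finally show "emeasure (dirichlet k a) (space (dirichlet k a)) \<noteq> \<infinity>" by simp
qed

lemma AE_dirichlet_prob_simplex: "AE p in dirichlet k a. p \<in> prob_simplex k"
  unfolding dirichlet_def
proof (subst AE_distr_iff)
  show "simplex_point k \<in> measurable (density (PiM {1..<k} (\<lambda>_. lborel))
      (\<lambda>y. ennreal (dirichlet_density k a (simplex_point k y)))) (PiM {1..k} (\<lambda>_. borel))"
    using measurable_simplex_point by simp
  show "{p \<in> space (PiM {1..k} (\<lambda>_. borel)). p \<in> prob_simplex k} \<in> sets (PiM {1..k} (\<lambda>_. borel))"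
    using pred_prob_simplex by measurable
  show "AE y in density (PiM {1..<k} (\<lambda>_. lborel)) (\<lambda>y. ennreal (dirichlet_density k a (simplex_point k y))).
      simplex_point k y \<in> prob_simplex k"
    using measurable_compose[OF measurable_simplex_point measurable_dirichlet_density]
    by (subst AE_density) (auto simp: dirichlet_density_def split: if_splits)
qed

lemma dirichlet_density_bounds:
  assumes h: "0 < h"
  shows "\<exists>c>0. \<exists>C>0. \<forall>p\<in>prob_simplex k. (\<forall>j\<in>{1..k}. h \<le> p j) \<longrightarrow>
    c \<le> dirichlet_density k a p \<and> dirichlet_density k a p \<le> C"
proof -
  obtain Z where Z: "0 < Z" and dens: "\<And>p. dirichlet_density k a p =
      (if p \<in> prob_simplex k \<and> (\<forall>j\<in>{1..k}. 0 < p j) then Z * (\<Prod>j\<in>{1..k}. p j powr (a j - 1)) else 0)"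
    using dirichlet_density_eq by blast
  let ?c = "Z * (\<Prod>j\<in>{1..k}. h powr \<bar>a j - 1\<bar>)" and ?C = "Z * (\<Prod>j\<in>{1..k}. h powr (- \<bar>a j - 1\<bar>))"
  have "?c \<le> dirichlet_density k a p \<and> dirichlet_density k a p \<le> ?C"
    if p: "p \<in> prob_simplex k" "\<forall>j\<in>{1..k}. h \<le> p j" for p
  proof -
    have "\<forall>j\<in>{1..k}. 0 < p j" using p(2) h by force
    then have eq: "dirichlet_density k a p = Z * (\<Prod>j\<in>{1..k}. p j powr (a j - 1))"
      unfolding dens using p(1) by simp
    show ?thesis unfolding eq
      using Z p prob_simplex_le_1[OF p(1)] h
      by (intro conjI mult_left_mono prod_mono powr_bounds) auto
  qed
  moreover have "0 < ?c" "0 < ?C" using Z h by (auto intro!: mult_pos_pos prod_pos)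
  ultimately show ?thesis by blast
qed

lemma emeasure_lborel_cube:
  fixes q :: "nat \<Rightarrow> real"
  assumes "0 \<le> \<rho>"
  shows "emeasure (PiM {1..<k} (\<lambda>_. lborel)) (PiE {1..<k} (\<lambda>j. {q j - \<rho>..q j + \<rho>})) = ennreal ((2 * \<rho>) ^ (k - 1))"
proof -
  interpret product_sigma_finite "\<lambda>_ :: nat. lborel :: real measure" ..
  have "emeasure (PiM {1..<k} (\<lambda>_. lborel)) (PiE {1..<k} (\<lambda>j. {q j - \<rho>..q j + \<rho>}))
      = (\<Prod>j\<in>{1..<k}. emeasure lborel {q j - \<rho>..q j + \<rho>})"
    by (intro emeasure_PiM) auto
  also have "\<dots> = (\<Prod>j\<in>{1..<k}. ennreal (2 * \<rho>))" using assms by (intro prod.cong) auto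
  finally show ?thesis using assms by (simp add: ennreal_power)
qed

text \<open>Membership in the cube bounds all \<open>k\<close> coordinates below by \<open>h\<close>, so the density is bounded there.
  The bound on the last coordinate is then dropped, which leaves a cube in the first \<open>k - 1\<close>
  coordinates.\<close>
lemma dirichlet_cube_upper:
  assumes h: "0 < h"
  shows "\<exists>C>0. \<forall>q \<rho>. 0 < \<rho> \<and> (\<forall>j\<in>{1..k}. h + \<rho> \<le> q j) \<longrightarrow>
    measure (dirichlet k a) {p \<in> space (dirichlet k a). \<forall>j\<in>{1..k}. \<bar>p j - q j\<bar> \<le> \<rho>} \<le> C * \<rho> ^ (k - 1)"
proof -
  obtain c C where C: "0 < C" and dens: "\<And>p. p \<in> prob_simplex k \<Longrightarrow> \<forall>j\<in>{1..k}. h \<le> p j \<Longrightarrow>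
    c \<le> dirichlet_density k a p \<and> dirichlet_density k a p \<le> C"
    using dirichlet_density_bounds[OF h] by blast
  have "measure (dirichlet k a) {p \<in> space (dirichlet k a). \<forall>j\<in>{1..k}. \<bar>p j - q j\<bar> \<le> \<rho>} \<le> C * 2 ^ (k - 1) * \<rho> ^ (k - 1)"
    if \<rho>: "0 < \<rho>" and q: "\<forall>j\<in>{1..k}. h + \<rho> \<le> q j" for q \<rho>
  proof -
    let ?E = "{p \<in> space (PiM {1..k} (\<lambda>_. borel)). \<forall>j\<in>{1..k}. \<bar>p j - q j\<bar> \<le> \<rho>}"
    let ?Q = "PiE {1..<k} (\<lambda>j. {q j - \<rho>..q j + \<rho>})"
    have [measurable]: "(\<lambda>p. p j) \<in> borel_measurable (PiM {1..k} (\<lambda>_. borel :: real measure))" if "j \<in> {1..k}" for j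
      using that by measurable
    have E: "?E \<in> sets (PiM {1..k} (\<lambda>_. borel))" by measurable
    have Q: "?Q \<in> sets (PiM {1..<k} (\<lambda>_. lborel))" by (intro sets_PiM_I_finite) auto
    have "emeasure (dirichlet k a) ?E \<le> (\<integral>\<^sup>+ y. ennreal C * indicator ?Q y \<partial>PiM {1..<k} (\<lambda>_. lborel))"
      unfolding emeasure_dirichlet[OF E]
    proof (rule nn_integral_mono)
      fix y assume y: "y \<in> space (PiM {1..<k} (\<lambda>_. lborel :: real measure))"
      show "ennreal (dirichlet_density k a (simplex_point k y)) * indicator ?E (simplex_point k y)
          \<le> ennreal C * indicator ?Q y"
      proof (cases "simplex_point k y \<in> ?E \<and> simplex_point k y \<in> prob_simplex k")
        case True
        then have dev: "\<bar>simplex_point k y j - q j\<bar> \<le> \<rho>" if "j \<in> {1..k}" for j using that by auto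
        have "\<bar>y j - q j\<bar> \<le> \<rho>" if "j \<in> {1..<k}" for j
          using dev[of j] that by (simp add: simplex_point_def)
        then have "y \<in> ?Q" using y by (auto simp: space_PiM PiE_iff abs_le_iff algebra_simps)
        moreover have "h \<le> simplex_point k y j" if "j \<in> {1..k}" for j
          using dev[OF that] q that by (force simp: abs_le_iff)
        then have "dirichlet_density k a (simplex_point k y) \<le> C" using dens True by blast
        ultimately show ?thesis by (auto simp: indicator_def intro!: ennreal_leI)
      next
        case False
        then show ?thesis by (auto simp: indicator_def dirichlet_density_def)
      qed
    qed
    also have "\<dots> = ennreal C * ennreal ((2 * \<rho>) ^ (k - 1))"
      by (simp only: nn_integral_cmult_indicator[OF Q] emeasure_lborel_cube[OF less_imp_le[OF \<rho>]])
    also have "\<dots> = ennreal (C * 2 ^ (k - 1) * \<rho> ^ (k - 1))"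
      using C \<rho> by (simp add: ennreal_mult[symmetric] power_mult_distrib mult.assoc)
    finally show ?thesis unfolding space_dirichlet measure_def using C \<rho>
      by (intro enn2real_leI) auto
  qed
  then show ?thesis using C by (intro exI[of _ "C * 2 ^ (k - 1)"]) auto
qed

text \<open>If the first \<open>k - 1\<close> coordinates move by at most \<open>\<rho>\<close>, the last one moves by at most \<open>k \<rho>\<close>. Hence the
  whole cube in the first \<open>k - 1\<close> coordinates stays where all coordinates are at least \<open>h\<close> and the
  density is bounded below.\<close>
lemma dirichlet_cube_lower:
  assumes h: "0 < h"
  shows "\<exists>c>0. \<forall>q \<rho>. q \<in> prob_simplex k \<and> 0 < \<rho> \<and> (\<forall>j\<in>{1..k}. h + real k * \<rho> \<le> q j) \<longrightarrow>
    c * \<rho> ^ (k - 1) \<le> measure (dirichlet k a)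
      {p \<in> space (dirichlet k a). p \<in> prob_simplex k \<and> (\<forall>j\<in>{1..<k}. \<bar>p j - q j\<bar> \<le> \<rho>)}"
proof -
  interpret D: finite_measure "dirichlet k a" by (rule finite_measure_dirichlet)
  obtain c C where c: "0 < c" and dens: "\<And>p. p \<in> prob_simplex k \<Longrightarrow> \<forall>j\<in>{1..k}. h \<le> p j \<Longrightarrow>
    c \<le> dirichlet_density k a p \<and> dirichlet_density k a p \<le> C"
    using dirichlet_density_bounds[OF h] by blast
  have "c * 2 ^ (k - 1) * \<rho> ^ (k - 1) \<le> measure (dirichlet k a)
      {p \<in> space (dirichlet k a). p \<in> prob_simplex k \<and> (\<forall>j\<in>{1..<k}. \<bar>p j - q j\<bar> \<le> \<rho>)}"
    if qs: "q \<in> prob_simplex k" and \<rho>: "0 < \<rho>" and q: "\<forall>j\<in>{1..k}. h + real k * \<rho> \<le> q j" for q \<rho>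
  proof -
    let ?E = "{p \<in> space (PiM {1..k} (\<lambda>_. borel)). p \<in> prob_simplex k \<and> (\<forall>j\<in>{1..<k}. \<bar>p j - q j\<bar> \<le> \<rho>)}"
    let ?Q = "PiE {1..<k} (\<lambda>j. {q j - \<rho>..q j + \<rho>})"
    have [measurable]: "(\<lambda>p. p j) \<in> borel_measurable (PiM {1..k} (\<lambda>_. borel :: real measure))" if "j \<in> {1..<k}" for j
      using that by simp
    note pred_prob_simplex[measurable]
    have E: "?E \<in> sets (PiM {1..k} (\<lambda>_. borel))" by measurable
    have Q: "?Q \<in> sets (PiM {1..<k} (\<lambda>_. lborel))" by (intro sets_PiM_I_finite) auto
    have "ennreal (c * 2 ^ (k - 1) * \<rho> ^ (k - 1)) = ennreal c * ennreal ((2 * \<rho>) ^ (k - 1))"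
      using c \<rho> by (simp add: ennreal_mult[symmetric] power_mult_distrib mult.assoc)
    also have "\<dots> = (\<integral>\<^sup>+ y. ennreal c * indicator ?Q y \<partial>PiM {1..<k} (\<lambda>_. lborel))"
      by (simp only: nn_integral_cmult_indicator[OF Q] emeasure_lborel_cube[OF less_imp_le[OF \<rho>]])
    also have "\<dots> \<le> emeasure (dirichlet k a) ?E"
      unfolding emeasure_dirichlet[OF E]
    proof (rule nn_integral_mono)
      fix y assume "y \<in> space (PiM {1..<k} (\<lambda>_. lborel :: real measure))"
      then have sp: "simplex_point k y \<in> space (PiM {1..k} (\<lambda>_. borel))"
        using measurable_space[OF measurable_simplex_point] by blast
      show "ennreal c * indicator ?Q y
        \<le> ennreal (dirichlet_density k a (simplex_point k y)) * indicator ?E (simplex_point k y)"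
      proof (cases "y \<in> ?Q")
        case True
        have dev: "\<bar>y j - q j\<bar> \<le> \<rho>" if "j \<in> {1..<k}" for j
          using PiE_mem[OF True that] by (auto simp: abs_le_iff)
        have split: "sum q {1..k} = sum q {1..<k} + q k"
          using k by (intro sum_split_last) simp
        have ge: "h \<le> simplex_point k y j" if j: "j \<in> {1..k}" for j
        proof (cases "j = k")
          case False
          have "1 * \<rho> \<le> real k * \<rho>" using k \<rho> by (intro mult_right_mono) auto
          then show ?thesis using dev[of j] q j False by (force simp: simplex_point_def abs_le_iff)
        next
          case True
          have "(\<Sum>i\<in>{1..<k}. y i) - (\<Sum>i\<in>{1..<k}. q i) \<le> (\<Sum>i\<in>{1..<k}. \<rho>)"
            unfolding sum_subtractf[symmetric] using dev by (intro sum_mono) (auto simp: abs_le_iff)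
          also have "\<dots> \<le> real k * \<rho>" using \<rho> by (simp add: mult_right_mono)
          finally have "q k - real k * \<rho> \<le> simplex_point k y k"
            using qs split k by (simp add: simplex_point_def prob_simplex_def)
          moreover have "h + real k * \<rho> \<le> q k" using q k by simp
          ultimately show ?thesis unfolding True by linarith
        qed
        have "0 \<le> y j" if "j \<in> {1..<k}" for j
          using ge[of j] that h by (simp add: simplex_point_def)
        moreover have "(\<Sum>i\<in>{1..<k}. y i) \<le> 1" using ge[of k] k h by (simp add: simplex_point_def)
        ultimately have simp: "simplex_point k y \<in> prob_simplex k"
          using k by (subst simplex_point_in_prob_simplex) auto
        then have "c \<le> dirichlet_density k a (simplex_point k y)" using dens ge by blast
        moreover have "simplex_point k y \<in> ?E"
          using sp simp dev by (auto simp: simplex_point_def)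
        ultimately show ?thesis by (auto simp: indicator_def intro!: ennreal_leI)
      qed simp
    qed
    finally show ?thesis unfolding space_dirichlet D.emeasure_eq_measure by (simp add: ennreal_le_iff)
  qed
  then show ?thesis using c by (intro exI[of _ "c * 2 ^ (k - 1)"]) auto
qed

end

section \<open>The average Type II error\<close>
lemma measurable_multinomial_prob:
  "(\<lambda>p. multinomial_prob k n p m) \<in> borel_measurable (PiM {1..k} (\<lambda>_. borel))"
proof -
  have [measurable]: "(\<lambda>p. p j) \<in> borel_measurable (PiM {1..k} (\<lambda>_. borel :: real measure))" if "j \<in> {1..k}" for j
    using that by measurable
  show ?thesis unfolding multinomial_prob_def by measurable
qed

lemma type2_prob_eq_sum:
  assumes "p \<in> prob_simplex k"
  shows "type2_prob k n p0 p x = (\<Sum>m | m \<in> compositions k n \<and> chi_square k n p0 m \<le> x. multinomial_prob k n p m)"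
  unfolding type2_prob_def pearson_eq_chi_square by (rule prob_cell_counts[OF assms])

text \<open>The Type II error is a polynomial in \<open>p\<close> on the simplex and constant off it.\<close>
lemma measurable_type2_prob:
  "(\<lambda>p. type2_prob k n p0 p x) \<in> borel_measurable (dirichlet k a)"
proof -
  have off: "(\<lambda>_. 0) \<notin> prob_simplex k" by (simp add: prob_simplex_def)
  define c where "c = type2_prob k n p0 (\<lambda>_. 0) x"
  have eq: "type2_prob k n p0 p x = (if p \<in> prob_simplex k
      then (\<Sum>m | m \<in> compositions k n \<and> chi_square k n p0 m \<le> x. multinomial_prob k n p m)
      else c)" for p
    using off by (simp add: type2_prob_eq_sum) (simp add: c_def type2_prob_def iid_sample_def categorical_pmf_def)
  note pred_prob_simplex[measurable] measurable_multinomial_prob[measurable]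
  show ?thesis unfolding eq by measurable
qed

context
  fixes k :: nat and p0 a :: "nat \<Rightarrow> real"
  assumes k: "2 \<le> k" and p0: "p0 \<in> prob_simplex k" "\<forall>j\<in>{1..k}. 0 < p0 j"
    and a: "\<forall>j\<in>{1..k}. 0 < a j"
begin

text \<open>Within the simplex, the Euclidean ball of radius \<open>\<epsilon>\<close> contains the cube of half-side \<open>\<epsilon> / (2 k)\<close> in the
  first \<open>k - 1\<close> coordinates, and it is contained in the cube of half-side \<open>\<epsilon>\<close>.\<close>
lemma dirichlet_ball_bounds:
  "\<exists>\<epsilon>0 c C. 0 < \<epsilon>0 \<and> 0 < c \<and> 0 < C \<and> (\<forall>\<epsilon>. 0 < \<epsilon> \<and> \<epsilon> \<le> \<epsilon>0 \<longrightarrow>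
     c * \<epsilon> ^ (k - 1) \<le>
       measure (dirichlet k a) {p \<in> space (dirichlet k a). L2_set (\<lambda>j. p j - p0 j) {1..k} \<le> \<epsilon>} \<and>
     measure (dirichlet k a) {p \<in> space (dirichlet k a). L2_set (\<lambda>j. p j - p0 j) {1..k} \<le> \<epsilon>}
       \<le> C * \<epsilon> ^ (k - 1))"
proof -
  interpret D: finite_measure "dirichlet k a" by (rule finite_measure_dirichlet[OF k a])
  obtain \<delta> where \<delta>: "0 < \<delta>" "\<And>j. j \<in> {1..k} \<Longrightarrow> \<delta> \<le> p0 j"
    using p0_bounds[OF k p0] by auto
  have k1: "1 \<le> k" using k by simp
  have h: "0 < \<delta> / 2" using \<delta> by simp
  obtain C where C: "0 < C" and up: "\<And>q \<rho>. 0 < \<rho> \<Longrightarrow> \<forall>j\<in>{1..k}. \<delta>/2 + \<rho> \<le> q j \<Longrightarrow>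
    measure (dirichlet k a) {p \<in> space (dirichlet k a). \<forall>j\<in>{1..k}. \<bar>p j - q j\<bar> \<le> \<rho>} \<le> C * \<rho> ^ (k - 1)"
    using dirichlet_cube_upper[OF k a h] by blast
  obtain c where c: "0 < c" and lo: "\<And>q \<rho>. q \<in> prob_simplex k \<Longrightarrow> 0 < \<rho> \<Longrightarrow> \<forall>j\<in>{1..k}. \<delta>/2 + real k * \<rho> \<le> q j \<Longrightarrow>
    c * \<rho> ^ (k - 1) \<le> measure (dirichlet k a)
      {p \<in> space (dirichlet k a). p \<in> prob_simplex k \<and> (\<forall>j\<in>{1..<k}. \<bar>p j - q j\<bar> \<le> \<rho>)}"
    using dirichlet_cube_lower[OF k a h] by blast
  have [measurable]: "(\<lambda>p. p j) \<in> borel_measurable (dirichlet k a)" if "j \<in> {1..k}" for j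
    using that unfolding measurable_cong_sets[OF sets_dirichlet refl] by measurable
  have "(c / (2 * real k) ^ (k - 1)) * \<epsilon> ^ (k - 1) \<le>
       measure (dirichlet k a) {p \<in> space (dirichlet k a). L2_set (\<lambda>j. p j - p0 j) {1..k} \<le> \<epsilon>} \<and>
     measure (dirichlet k a) {p \<in> space (dirichlet k a). L2_set (\<lambda>j. p j - p0 j) {1..k} \<le> \<epsilon>}
       \<le> C * \<epsilon> ^ (k - 1)" if \<epsilon>: "0 < \<epsilon>" "\<epsilon> \<le> \<delta>/2" for \<epsilon>
  proof
    let ?E = "{p \<in> space (dirichlet k a). L2_set (\<lambda>j. p j - p0 j) {1..k} \<le> \<epsilon>}"
    have E: "?E \<in> sets (dirichlet k a)" unfolding L2_set_def by measurable
    define \<rho> where "\<rho> = \<epsilon> / (2 * real k)"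
    have \<rho>: "0 < \<rho>" "real k * \<rho> = \<epsilon> / 2" using \<epsilon> k by (auto simp: \<rho>_def)
    have "(c / (2 * real k) ^ (k - 1)) * \<epsilon> ^ (k - 1) = c * \<rho> ^ (k - 1)"
      by (simp add: \<rho>_def power_divide)
    also have "\<dots> \<le> measure (dirichlet k a)
        {p \<in> space (dirichlet k a). p \<in> prob_simplex k \<and> (\<forall>j\<in>{1..<k}. \<bar>p j - p0 j\<bar> \<le> \<rho>)}"
    proof (intro lo p0(1) \<rho>(1) ballI)
      fix j assume "j \<in> {1..k}"
      from \<delta>(2)[OF this] show "\<delta>/2 + real k * \<rho> \<le> p0 j" unfolding \<rho>(2) using \<epsilon> by linarith
    qed
    also have "\<dots> \<le> measure (dirichlet k a) ?E"
    proof (rule D.finite_measure_mono[OF _ E], safe)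
      fix p assume p: "p \<in> prob_simplex k" "\<forall>j\<in>{1..<k}. \<bar>p j - p0 j\<bar> \<le> \<rho>"
      have "(\<Sum>j\<in>{1..k}. p j - p0 j) = 0" using p(1) p0(1) by (simp add: sum_subtractf prob_simplex_def)
      then have last: "p k - p0 k = - (\<Sum>j\<in>{1..<k}. p j - p0 j)"
        unfolding sum_split_last[OF k1] by simp
      have s: "(\<Sum>j\<in>{1..<k}. \<bar>p j - p0 j\<bar>) \<le> real k * \<rho>"
      proof -
        have "(\<Sum>j\<in>{1..<k}. \<bar>p j - p0 j\<bar>) \<le> real (card {1..<k}) * \<rho>"
          using p(2) by (intro sum_bounded_above) auto
        also have "\<dots> \<le> real k * \<rho>" using \<rho> by (intro mult_right_mono) auto
        finally show ?thesis .
      qed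
      have "L2_set (\<lambda>j. p j - p0 j) {1..k} \<le> (\<Sum>j\<in>{1..k}. \<bar>p j - p0 j\<bar>)" by (rule L2_set_le_sum_abs)
      also have "\<dots> = (\<Sum>j\<in>{1..<k}. \<bar>p j - p0 j\<bar>) + \<bar>p k - p0 k\<bar>" by (rule sum_split_last[OF k1])
      also have "\<bar>p k - p0 k\<bar> \<le> (\<Sum>j\<in>{1..<k}. \<bar>p j - p0 j\<bar>)" unfolding last abs_minus_cancel by (rule sum_abs)
      finally show "L2_set (\<lambda>j. p j - p0 j) {1..k} \<le> \<epsilon>" using s \<rho>(2) by linarith
    qed
    finally show "(c / (2 * real k) ^ (k - 1)) * \<epsilon> ^ (k - 1) \<le> measure (dirichlet k a) ?E" .
    have "measure (dirichlet k a) ?E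
        \<le> measure (dirichlet k a) {p \<in> space (dirichlet k a). \<forall>j\<in>{1..k}. \<bar>p j - p0 j\<bar> \<le> \<epsilon>}"
    proof (rule D.finite_measure_mono)
      show "{p \<in> space (dirichlet k a). \<forall>j\<in>{1..k}. \<bar>p j - p0 j\<bar> \<le> \<epsilon>} \<in> sets (dirichlet k a)" by measurable
      have "\<bar>p j - p0 j\<bar> \<le> L2_set (\<lambda>j. p j - p0 j) {1..k}" if "j \<in> {1..k}" for p j
      proof -
        have "(p j - p0 j)\<^sup>2 \<le> (\<Sum>j\<in>{1..k}. (p j - p0 j)\<^sup>2)"
          using that by (intro member_le_sum) auto
        then show ?thesis unfolding L2_set_def by (metis real_sqrt_abs real_sqrt_le_mono)
      qed
      then show "?E \<subseteq> {p \<in> space (dirichlet k a). \<forall>j\<in>{1..k}. \<bar>p j - p0 j\<bar> \<le> \<epsilon>}"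
        by (auto simp only: mem_Collect_eq intro!: subsetI) (rule order_trans)
    qed
    also have "\<dots> \<le> C * \<epsilon> ^ (k - 1)"
    proof (intro up \<epsilon>(1) ballI)
      fix j assume "j \<in> {1..k}"
      from \<delta>(2)[OF this] show "\<delta>/2 + \<epsilon> \<le> p0 j" using \<epsilon> by linarith
    qed
    finally show "measure (dirichlet k a) ?E \<le> C * \<epsilon> ^ (k - 1)" .
  qed
  moreover have "0 < c / (2 * real k) ^ (k - 1)" using c k by simp
  ultimately show ?thesis using C h by blast
qed

lemma integrable_type2_prob: "integrable (dirichlet k a) (\<lambda>p. type2_prob k n p0 p x)"
proof -
  interpret D: finite_measure "dirichlet k a" by (rule finite_measure_dirichlet[OF k a])
  show ?thesis
  proof (rule D.integrable_const_bound)
    show "AE p in dirichlet k a. norm (type2_prob k n p0 p x) \<le> 1" by (simp add: type2_prob_def)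
  qed (rule measurable_type2_prob)
qed

text \<open>Acceptance keeps the count of category \<open>j\<close> within \<open>sqrt (n x)\<close> of \<open>n p0 j\<close>, hence at a distance of at
  least \<open>t\<close> from its mean \<open>n p j\<close>.\<close>
lemma type2_prob_far:
  assumes n: "1 \<le> n" and p: "p \<in> prob_simplex k" and j: "j \<in> {1..k}" and x: "0 \<le> x" and t: "0 \<le> t"
    and far: "sqrt (real n * x) + t \<le> real n * \<bar>p j - p0 j\<bar>"
  shows "type2_prob k n p0 p x \<le> 2 * exp (- 2 * t\<^sup>2 / real n)"
proof -
  have "type2_prob k n p0 p x
      \<le> measure_pmf.prob (iid_sample k n p) {X. t \<le> \<bar>real (category_count n X j) - real n * p j\<bar>}"
    unfolding type2_prob_def
  proof (rule measure_pmf.finite_measure_mono)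
    show "{X. pearson k n p0 X \<le> x} \<subseteq> {X. t \<le> \<bar>real (category_count n X j) - real n * p j\<bar>}"
    proof safe
      fix X assume "pearson k n p0 X \<le> x"
      then have "\<bar>real (cell_counts k n X j) - real n * p0 j\<bar> \<le> sqrt (real n * x)"
        unfolding pearson_eq_chi_square by (intro chi_square_deviation[OF k p0 n j])
      then have "\<bar>real (category_count n X j) - real n * p0 j\<bar> \<le> sqrt (real n * x)"
        using j by (simp add: cell_counts_def)
      moreover have "real n * \<bar>p j - p0 j\<bar> = \<bar>real n * p j - real n * p0 j\<bar>"
        by (simp add: abs_mult flip: right_diff_distrib)
      ultimately show "t \<le> \<bar>real (category_count n X j) - real n * p j\<bar>" using far by linarith
    qed
  qed simp
  also have "\<dots> \<le> 2 * exp (- 2 * t\<^sup>2 / real n)"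
    by (rule prob_category_count_deviation[OF p j t n])
  finally show ?thesis .
qed

text \<open>Split the prior at distance \<open>\<rho> = G sqrt (ln n / n)\<close> from \<open>p0\<close>. The inner part has mass of order
  \<open>\<rho> ^ (k - 1)\<close>; on the outer part the test accepts with polynomially small probability.\<close>
lemma average_type2_upper:
  assumes B: "0 < B"
  shows "\<exists>C>0. \<forall>\<^sub>F n in sequentially. \<forall>x. 0 \<le> x \<and> x \<le> B * ln n \<longrightarrow>
    (\<integral>p. type2_prob k n p0 p x \<partial>dirichlet k a) \<le> C * (ln n / real n) powr ((real k - 1) / 2)"
proof -
  interpret D: finite_measure "dirichlet k a" by (rule finite_measure_dirichlet[OF k a])
  let ?D = "dirichlet k a"
  let ?e = "(real k - 1) / 2"
  obtain \<delta> where \<delta>: "0 < \<delta>" "\<And>j. j \<in> {1..k} \<Longrightarrow> \<delta> \<le> p0 j"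
    using p0_bounds[OF k p0] by auto
  have h: "0 < \<delta> / 2" using \<delta> by simp
  obtain C where C: "0 < C" and up: "\<And>q \<rho>. 0 < \<rho> \<Longrightarrow> \<forall>j\<in>{1..k}. \<delta>/2 + \<rho> \<le> q j \<Longrightarrow>
    measure ?D {p \<in> space ?D. \<forall>j\<in>{1..k}. \<bar>p j - q j\<bar> \<le> \<rho>} \<le> C * \<rho> ^ (k - 1)"
    using dirichlet_cube_upper[OF k a h] by blast
  have [measurable]: "(\<lambda>p. p j) \<in> borel_measurable ?D" if "j \<in> {1..k}" for j
    using that unfolding measurable_cong_sets[OF sets_dirichlet refl] by measurable
  \<comment> \<open>Acceptance uses up \<open>sqrt B\<close> of \<open>G\<close>. The rest leaves the exponent \<open>- 2 k\<^sup>2 ln n\<close> in Hoeffding's inequality,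
      which is below \<open>- (k - 1) / 2 * ln n\<close>.\<close>
  define G where "G = sqrt B + real k"
  have G: "0 < G" using B k by (simp add: G_def add_pos_pos)
  have ev1: "\<forall>\<^sub>F n in sequentially. 1 \<le> ln (real n)" by real_asymp
  have ev2: "\<forall>\<^sub>F n in sequentially. G * sqrt (ln n / real n) \<le> \<delta> / 2" using G \<delta>(1) by real_asymp
  let ?C = "C * G ^ (k - 1) + 2 * measure ?D (space ?D)"
  have "\<forall>\<^sub>F n in sequentially. \<forall>x. 0 \<le> x \<and> x \<le> B * ln n \<longrightarrow>
    (\<integral>p. type2_prob k n p0 p x \<partial>?D) \<le> ?C * (ln n / real n) powr ?e"
    using ev1 ev2 eventually_ge_at_top[of 1]
  proof eventually_elim
    case (elim n)
    show ?case
    proof (intro allI impI)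
      fix x assume x: "0 \<le> x \<and> x \<le> B * ln n"
      define \<rho> where "\<rho> = G * sqrt (ln n / real n)"
      have nln: "0 < ln n / real n" using elim(1,3) by (intro divide_pos_pos) linarith+
      have \<rho>: "0 < \<rho>" "\<rho> \<le> \<delta> / 2" using G nln elim(2) by (auto simp: \<rho>_def)
      let ?E = "{p \<in> space ?D. \<forall>j\<in>{1..k}. \<bar>p j - p0 j\<bar> \<le> \<rho>}"
      have E: "?E \<in> sets ?D" by measurable
      have sq: "real n * sqrt (ln n / real n) = sqrt (real n * ln n)"
        using elim(3) by (simp add: real_sqrt_divide real_sqrt_mult field_simps)
      have ptw: "type2_prob k n p0 p x \<le> indicator ?E p + 2 * (ln n / real n) powr ?e"
        if p: "p \<in> prob_simplex k" "p \<in> space ?D" for p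
      proof (cases "p \<in> ?E")
        case True
        have "type2_prob k n p0 p x \<le> 1" by (simp add: type2_prob_def)
        moreover have "0 \<le> (ln n / real n) powr ?e" by simp
        ultimately show ?thesis using True by (simp only: indicator_simps)
      next
        case False
        then obtain j where j: "j \<in> {1..k}" "\<rho> < \<bar>p j - p0 j\<bar>" using p(2) by force
        have "sqrt (real n * x) + real k * sqrt (real n * ln n) \<le> real n * \<rho>"
        proof -
          have "sqrt (real n * x) \<le> sqrt (real n * (B * ln n))"
            using x by (intro real_sqrt_le_mono mult_left_mono) auto
          also have "\<dots> = sqrt B * sqrt (real n * ln n)" by (simp add: real_sqrt_mult)
          finally have "sqrt (real n * x) + real k * sqrt (real n * ln n) \<le> G * sqrt (real n * ln n)"
            by (simp add: G_def ring_distribs)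
          also have "\<dots> = real n * \<rho>" unfolding \<rho>_def sq[symmetric] by simp
          finally show ?thesis .
        qed
        also have "\<dots> \<le> real n * \<bar>p j - p0 j\<bar>" using j(2) by (intro mult_left_mono) auto
        finally have "type2_prob k n p0 p x \<le> 2 * exp (- 2 * (real k * sqrt (real n * ln n))\<^sup>2 / real n)"
          using x elim(1) by (intro type2_prob_far[OF elim(3) p(1) j(1)]) auto
        also have "(real k * sqrt (real n * ln n))\<^sup>2 = real k * real k * (real n * ln n)"
          using elim(1) by (simp add: power_mult_distrib) (simp add: power2_eq_square)
        also have "- 2 * (real k * real k * (real n * ln n)) / real n = - (2 * (real k * real k)) * ln n"
          using elim(3) by simp
        also have "exp (- (2 * (real k * real k)) * ln n) \<le> exp (- ?e * ln n)"
        proof -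
          have "?e \<le> real k" by simp
          also have "\<dots> \<le> real k * real k" using k by simp
          also have "\<dots> \<le> 2 * (real k * real k)" by simp
          finally have "- (2 * (real k * real k)) \<le> - ?e" by simp
          then show ?thesis using elim(1) by (simp only: exp_le_cancel_iff, intro mult_right_mono) auto
        qed
        also have "exp (- ?e * ln n) = real n powr (- ?e)" using elim(3) by (simp add: powr_def)
        also have "\<dots> \<le> (ln n / real n) powr ?e"
        proof -
          have "real n powr (- ?e) = (1 / real n) powr ?e" using elim(3) by (simp add: powr_minus powr_divide divide_simps)
          also have "\<dots> \<le> (ln n / real n) powr ?e"
            using elim(1) k by (intro powr_mono2 divide_right_mono) auto
          finally show ?thesis .
        qed
        finally show ?thesis by (simp add: indicator_def)
      qed
      have "(\<integral>p. type2_prob k n p0 p x \<partial>?D) \<le> (\<integral>p. indicator ?E p + 2 * (ln n / real n) powr ?e \<partial>?D)"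
      proof (rule integral_mono_AE[OF integrable_type2_prob])
        show "integrable ?D (\<lambda>p. indicator ?E p + 2 * (ln n / real n) powr ?e)"
          using E by (intro Bochner_Integration.integrable_add integrable_real_indicator)
            (auto simp: D.emeasure_eq_measure)
        show "AE p in ?D. type2_prob k n p0 p x \<le> indicator ?E p + 2 * (ln n / real n) powr ?e"
          using AE_dirichlet_prob_simplex[OF k a] by (rule AE_mp) (intro AE_I2 impI ptw)
      qed
      also have "\<dots> = measure ?D ?E + measure ?D (space ?D) * (2 * (ln n / real n) powr ?e)"
        using E by (subst Bochner_Integration.integral_add) (auto simp: D.emeasure_eq_measure)
      also have "measure ?D ?E \<le> C * \<rho> ^ (k - 1)"
      proof (intro up \<rho>(1) ballI)
        fix j assume "j \<in> {1..k}"
        from \<delta>(2)[OF this] show "\<delta>/2 + \<rho> \<le> p0 j" using \<rho> by linarith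
      qed
      also have "\<rho> ^ (k - 1) = G ^ (k - 1) * (ln n / real n) powr ?e"
        unfolding \<rho>_def power_mult_distrib using k by (subst sqrt_power_eq_powr[OF nln, symmetric]) auto
      finally show "(\<integral>p. type2_prob k n p0 p x \<partial>?D) \<le> ?C * (ln n / real n) powr ?e"
        by (simp add: ring_distribs mult_ac)
    qed
  qed
  moreover have "0 < ?C" using C G by (intro add_pos_nonneg) auto
  ultimately show ?thesis by blast
qed

text \<open>Every count vector \<open>m\<close> in the shell has probability of order \<open>n powr (- (k - 1) / 2)\<close> for all \<open>p\<close> within
  \<open>1 / sqrt n\<close> of \<open>m / n\<close>, and those \<open>p\<close> have prior mass of the same order. So each of the
  \<open>(n / ln n) powr ((k - 1) / 2)\<close> lattice points of the shell contributes at least a multiple of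
  \<open>n powr (- (k - 1))\<close>.\<close>
lemma average_type2_shell:
  assumes B: "0 < B"
  shows "\<exists>c>0. \<forall>\<^sub>F n in sequentially. \<forall>x. 0 \<le> x \<and> x \<le> B * ln n \<longrightarrow>
    c * (real n * ln n) powr (- (real k - 1) / 2) \<le>
      (\<integral>p. type2_prob k n p0 p (x + 1) \<partial>dirichlet k a) - (\<integral>p. type2_prob k n p0 p x \<partial>dirichlet k a)"
proof -
  interpret D: finite_measure "dirichlet k a" by (rule finite_measure_dirichlet[OF k a])
  let ?D = "dirichlet k a"
  let ?e = "(real k - 1) / 2"
  have B1: "0 < B + 1" using B by simp
  obtain \<delta> where \<delta>: "0 < \<delta>" "\<And>j. j \<in> {1..k} \<Longrightarrow> \<delta> \<le> p0 j"
    using p0_bounds[OF k p0] by auto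
  have h: "0 < \<delta> / 2" using \<delta> by simp
  obtain c1 where c1: "0 < c1" and lo: "\<And>q \<rho>. q \<in> prob_simplex k \<Longrightarrow> 0 < \<rho> \<Longrightarrow> \<forall>j\<in>{1..k}. \<delta>/2 + real k * \<rho> \<le> q j \<Longrightarrow>
    c1 * \<rho> ^ (k - 1) \<le> measure ?D {p \<in> space ?D. p \<in> prob_simplex k \<and> (\<forall>j\<in>{1..<k}. \<bar>p j - q j\<bar> \<le> \<rho>)}"
    using dirichlet_cube_lower[OF k a h] by blast
  from multinomial_prob_lower_near[OF k p0 B1] obtain c2 where c2: "0 < c2"
    and ev1: "\<forall>\<^sub>F n in sequentially. \<forall>m\<in>compositions k n. chi_square k n p0 m \<le> (B + 1) * ln n \<longrightarrow>
      (\<forall>p\<in>prob_simplex k. (\<forall>j\<in>{1..<k}. \<bar>p j - real (m j) / real n\<bar> \<le> 1 / sqrt n) \<longrightarrow>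
        c2 * real n powr (- (real k - 1) / 2) \<le> multinomial_prob k n p m)"
    by auto
  from chi_square_shell_count[OF k p0 B] obtain c3 where c3: "0 < c3"
    and ev2: "\<forall>\<^sub>F n in sequentially. \<forall>x. 0 \<le> x \<and> x \<le> B * ln n \<longrightarrow>
      c3 * (real n / ln n) powr ((real k - 1) / 2)
        \<le> real (card {m \<in> compositions k n. x < chi_square k n p0 m \<and> chi_square k n p0 m \<le> x + 1})"
    by auto
  define K where "K = real k"
  have K: "1 \<le> K" using k by (simp add: K_def)
  have ev3: "\<forall>\<^sub>F n in sequentially. 1 \<le> ln (real n)" by real_asymp
  have ev4: "\<forall>\<^sub>F n in sequentially. K * (1 / sqrt n) + sqrt (real n * ((B + 1) * ln n)) / real n \<le> \<delta> / 2"
    using \<delta>(1) B K by real_asymp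
  let ?c = "c3 * c2 * c1"
  have "\<forall>\<^sub>F n in sequentially. \<forall>x. 0 \<le> x \<and> x \<le> B * ln n \<longrightarrow>
    ?c * (real n * ln n) powr (- (real k - 1) / 2) \<le>
      (\<integral>p. type2_prob k n p0 p (x + 1) \<partial>?D) - (\<integral>p. type2_prob k n p0 p x \<partial>?D)"
    using ev1 ev2 ev3 ev4 eventually_ge_at_top[of 1]
  proof eventually_elim
    case (elim n)
    show ?case
    proof (intro allI impI)
      fix x assume x: "0 \<le> x \<and> x \<le> B * ln n"
      let ?T = "{m \<in> compositions k n. x < chi_square k n p0 m \<and> chi_square k n p0 m \<le> x + 1}"
      let ?N = "real n powr (- ?e)"
      define E where "E m = {p \<in> space ?D. p \<in> prob_simplex k \<and> (\<forall>j\<in>{1..<k}. \<bar>p j - real (m j) / real n\<bar> \<le> 1 / sqrt n)}"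
        for m :: "nat \<Rightarrow> nat"
      have [measurable]: "(\<lambda>p. p j) \<in> borel_measurable ?D" if "j \<in> {1..<k}" for j
        using that unfolding measurable_cong_sets[OF sets_dirichlet refl] by simp
      have [measurable]: "Measurable.pred ?D (\<lambda>p. p \<in> prob_simplex k)"
        using pred_prob_simplex measurable_cong_sets[OF sets_dirichlet refl] by blast
      have E: "E m \<in> sets ?D" for m unfolding E_def by measurable
      have x1: "x + 1 \<le> (B + 1) * ln n" using x elim(3) by (simp add: ring_distribs)
      have fin: "finite ?T" by (rule finite_subset[OF _ finite_compositions]) auto
      have mE: "c1 * ?N \<le> measure ?D (E m)" if m: "m \<in> ?T" for m
      proof -
        have "c1 * (1 / sqrt n) ^ (k - 1) \<le> measure ?D (E m)"
          unfolding E_def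
        proof (intro lo ballI)
          show "(\<lambda>j. real (m j) / real n) \<in> prob_simplex k"
            using m elim(5) by (auto simp: prob_simplex_def compositions_def sum_divide_distrib[symmetric] simp flip: of_nat_sum)
          fix j assume j: "j \<in> {1..k}"
          have "\<bar>real (m j) - real n * p0 j\<bar> \<le> sqrt (real n * ((B + 1) * ln n))"
            using m x1 by (intro chi_square_deviation[OF k p0 elim(5) j]) auto
          then have "real n * p0 j - sqrt (real n * ((B + 1) * ln n)) \<le> real (m j)" by linarith
          then have "(real n * p0 j - sqrt (real n * ((B + 1) * ln n))) / real n \<le> real (m j) / real n"
            by (intro divide_right_mono) auto
          then have "p0 j - sqrt (real n * ((B + 1) * ln n)) / real n \<le> real (m j) / real n"
            using elim(5) by (simp add: diff_divide_distrib)
          then show "\<delta> / 2 + real k * (1 / sqrt n) \<le> real (m j) / real n"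
            using \<delta>(2)[OF j] elim(4) unfolding K_def by linarith
        qed (use elim(5) in auto)
        also have "(1 / sqrt n) ^ (k - 1) = ?N"
        proof -
          have "sqrt (1 / n) ^ (k - Suc 0) = (1 / n) powr ?e" using elim(5) k by (intro sqrt_power_eq_powr) auto
          then show ?thesis using elim(5) by (simp add: real_sqrt_divide powr_divide powr_minus divide_simps)
        qed
        finally show ?thesis .
      qed
      \<comment> \<open>The boxes \<open>E m\<close> overlap, but for fixed \<open>p\<close> the events of seeing different counts are disjoint, so
          the contributions add up.\<close>
      have ptw: "(\<Sum>m\<in>?T. c2 * ?N * indicator (E m) p) \<le> type2_prob k n p0 p (x + 1) - type2_prob k n p0 p x"
        if p: "p \<in> prob_simplex k" for p
      proof -
        have "type2_prob k n p0 p (x + 1) = type2_prob k n p0 p x + (\<Sum>m\<in>?T. multinomial_prob k n p m)"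
          unfolding type2_prob_eq_sum[OF p] by (subst sum.union_disjoint[symmetric]) (auto intro!: sum.cong)
        moreover have "(\<Sum>m\<in>?T. c2 * ?N * indicator (E m) p) \<le> (\<Sum>m\<in>?T. multinomial_prob k n p m)"
        proof (rule sum_mono)
          fix m assume m: "m \<in> ?T"
          show "c2 * ?N * indicator (E m) p \<le> multinomial_prob k n p m"
          proof (cases "p \<in> E m")
            case True
            then show ?thesis using elim(1) m x1 p unfolding E_def minus_divide_left by auto
          qed (simp add: multinomial_prob_nonneg[OF p])
        qed
        ultimately show ?thesis by linarith
      qed
      have "real n powr ?e * ?N = 1" using elim(5) by (simp flip: powr_add)
      moreover have "(real n / ln n) powr ?e = real n powr ?e * ln n powr (- ?e)"
        using elim(3) by (simp add: powr_divide powr_minus divide_simps)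
      moreover have "(real n * ln n) powr (- ?e) = ?N * ln n powr (- ?e)"
        using elim(3) by (simp add: powr_mult)
      ultimately have "?c * (real n * ln n) powr (- ?e) = c3 * (real n / ln n) powr ?e * (c2 * ?N * (c1 * ?N))"
        by (simp add: mult_ac)
      also have "\<dots> \<le> real (card ?T) * (c2 * ?N * (c1 * ?N))"
        using elim(2) x c1 c2 by (intro mult_right_mono) auto
      also have "\<dots> = (\<Sum>m\<in>?T. c2 * ?N * (c1 * ?N))" by simp
      also have "\<dots> \<le> (\<Sum>m\<in>?T. c2 * ?N * measure ?D (E m))"
        using c2 mE by (intro sum_mono mult_left_mono) auto
      also have "\<dots> = (\<integral>p. (\<Sum>m\<in>?T. c2 * ?N * indicator (E m) p) \<partial>?D)"
        using E by (subst Bochner_Integration.integral_sum) (auto simp: D.emeasure_eq_measure)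
      also have "\<dots> \<le> (\<integral>p. type2_prob k n p0 p (x + 1) - type2_prob k n p0 p x \<partial>?D)"
      proof (rule integral_mono_AE)
        show "integrable ?D (\<lambda>p. \<Sum>m\<in>?T. c2 * ?N * indicator (E m) p)"
          using E by (intro Bochner_Integration.integrable_sum integrable_mult_right integrable_real_indicator)
            (auto simp: D.emeasure_eq_measure)
        show "AE p in ?D. (\<Sum>m\<in>?T. c2 * ?N * indicator (E m) p) \<le> type2_prob k n p0 p (x + 1) - type2_prob k n p0 p x"
          using AE_dirichlet_prob_simplex[OF k a] by (rule AE_mp) (intro AE_I2 impI ptw)
      qed (intro Bochner_Integration.integrable_diff integrable_type2_prob)
      also have "\<dots> = (\<integral>p. type2_prob k n p0 p (x + 1) \<partial>?D) - (\<integral>p. type2_prob k n p0 p x \<partial>?D)"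
        by (intro Bochner_Integration.integral_diff integrable_type2_prob)
      finally show "?c * (real n * ln n) powr (- (real k - 1) / 2) \<le>
          (\<integral>p. type2_prob k n p0 p (x + 1) \<partial>?D) - (\<integral>p. type2_prob k n p0 p x \<partial>?D)"
        unfolding minus_divide_left .
    qed
  qed
  then show ?thesis using c1 c2 c3 by (intro exI[of _ ?c]) auto
qed

end

section \<open>The optimal critical value\<close>

theorem theorem5p8:
  fixes k :: nat and p0 a :: "nat \<Rightarrow> real" and \<pi>0 \<pi>1 L0 L1 :: real
    and \<chi>_opt :: "nat \<Rightarrow> real"
  assumes k: "2 \<le> k"
    and p0: "p0 \<in> prob_simplex k" "\<forall>j\<in>{1..k}. 0 < p0 j"
    and weights: "0 < \<pi>0" "0 < \<pi>1" "\<pi>0 + \<pi>1 = 1"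
    and losses: "0 < L0" "0 < L1"
    and dirichlet_params: "\<forall>j\<in>{1..k}. 0 < a j"
    and prior_density: "\<exists>\<delta>>0. continuous_on (near_simplex k p0 \<delta>) (dirichlet_density k a) \<and>
          (\<forall>p\<in>near_simplex k p0 \<delta>. 0 < dirichlet_density k a p)"
    and optimal: "\<forall>n\<ge>1. bayes_optimal k p0 (dirichlet k a) \<pi>0 \<pi>1 L0 L1 n (\<chi>_opt n)"
  shows "(\<exists>\<epsilon>0 c C. 0 < \<epsilon>0 \<and> 0 < c \<and> 0 < C \<and>
           (\<forall>\<epsilon>. 0 < \<epsilon> \<and> \<epsilon> \<le> \<epsilon>0 \<longrightarrow>
              c * \<epsilon> ^ (k - 1) \<le>
                measure (dirichlet k a)
                  {p \<in> space (dirichlet k a). L2_set (\<lambda>j. p j - p0 j) {1..k} \<le> \<epsilon>} \<and>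
              measure (dirichlet k a)
                  {p \<in> space (dirichlet k a). L2_set (\<lambda>j. p j - p0 j) {1..k} \<le> \<epsilon>}
                \<le> C * \<epsilon> ^ (k - 1))) \<and>
         (\<lambda>n. \<chi>_opt n - (real k - 1) * ln (real n)) \<in> O(\<lambda>n. ln (ln (real n))) \<and>
         asymp_up_to_polylog (\<lambda>n. type1_prob k n p0 (\<chi>_opt n))
           (\<lambda>n. real n powr (- (real k - 1) / 2))"
proof -
  let ?D = "dirichlet k a"
  define e where "e = (real k - 1) / 2"
  have e0: "0 < e" using k by (simp add: e_def)
  have me: "- (real k - 1) / 2 = - e" unfolding e_def by (rule minus_divide_left[symmetric])
  define W0 where "W0 = \<pi>0 * L0"
  define W1 where "W1 = \<pi>1 * L1"
  have W: "0 < W0" "0 < W1" using weights losses by (auto simp: W0_def W1_def)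
  define \<beta> where "\<beta> n c = (\<integral>p. type2_prob k n p0 p c \<partial>?D)" for n c
  define \<alpha> where "\<alpha> n c = type1_prob k n p0 c" for n c
  define R where "R n c = W0 * \<alpha> n c + W1 * \<beta> n c" for n c
  have opt: "R n (\<chi>_opt n) \<le> R n c" if "1 \<le> n" for n c
  proof -
    have "bayes_optimal k p0 ?D \<pi>0 \<pi>1 L0 L1 n (\<chi>_opt n)" using optimal that by blast
    then have "\<not> bayes_risk k p0 ?D \<pi>0 \<pi>1 L0 L1 n c < bayes_risk k p0 ?D \<pi>0 \<pi>1 L0 L1 n (\<chi>_opt n)"
      unfolding bayes_optimal_def is_arg_min_def by blast
    then show ?thesis by (simp add: bayes_risk_def R_def \<alpha>_def \<beta>_def W0_def W1_def)
  qed
  have \<alpha>_mono: "\<alpha> n c' \<le> \<alpha> n c" if "c \<le> c'" for n c c'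
    unfolding \<alpha>_def type1_prob_def using that by (intro measure_pmf.finite_measure_mono) auto
  have \<beta>_mono: "\<beta> n c \<le> \<beta> n c'" if "c \<le> c'" for n c c'
    unfolding \<beta>_def
  proof (rule integral_mono[OF integrable_type2_prob integrable_type2_prob])
    show "type2_prob k n p0 p c \<le> type2_prob k n p0 p c'" for p
      unfolding type2_prob_def using that by (intro measure_pmf.finite_measure_mono) auto
  qed (fact k p0 dirichlet_params)+
  have \<alpha>_nonneg: "0 \<le> \<alpha> n c" for n c by (simp add: \<alpha>_def type1_prob_def)
  have \<beta>_nonneg: "0 \<le> \<beta> n c" for n c
    unfolding \<beta>_def by (intro Bochner_Integration.integral_nonneg) (simp add: type2_prob_def)
  define B where "B = 2 * e + 1"
  have B: "0 < B" using e0 by (simp add: B_def)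
  obtain c1 where c1: "0 < c1" and ev1: "\<forall>\<^sub>F n in sequentially. \<forall>x. 0 \<le> x \<and> x \<le> B * ln n \<longrightarrow>
      c1 * ln n powr (- e) * exp (- x / 2) \<le> \<alpha> n x"
    using type1_prob_lower[OF k p0 B] unfolding me \<alpha>_def by blast
  obtain C1 where C1: "0 < C1" and ev2: "\<forall>\<^sub>F n in sequentially. \<forall>x. 0 \<le> x \<and> x \<le> B * ln n \<longrightarrow>
      \<alpha> n x \<le> C1 * ln n powr e * exp (- x / 2)"
    using type1_prob_upper[OF k p0 B] unfolding e_def[symmetric] \<alpha>_def by blast
  obtain C2 where C2: "0 < C2" and ev3: "\<forall>\<^sub>F n in sequentially. \<forall>x. 0 \<le> x \<and> x \<le> B * ln n \<longrightarrow>
      \<beta> n x \<le> C2 * (ln n / real n) powr e"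
    using average_type2_upper[OF k p0 dirichlet_params B] unfolding e_def[symmetric] \<beta>_def by blast
  obtain c2 where c2: "0 < c2" and ev4: "\<forall>\<^sub>F n in sequentially. \<forall>x. 0 \<le> x \<and> x \<le> B * ln n \<longrightarrow>
      c2 * (real n * ln n) powr (- e) \<le> \<beta> n (x + 1) - \<beta> n x"
    using average_type2_shell[OF k p0 dirichlet_params B] unfolding me \<beta>_def by blast
  \<comment> \<open>In each of the two comparisons below the estimates lose a factor \<open>(ln n) powr (2 * e)\<close>. With
      \<open>H = 4 * e + 1\<close> the shift of the level gains \<open>exp (H * ln (ln n) / 2)\<close>, which exceeds that loss by
      the factor \<open>(ln n) powr (1/2)\<close>.\<close>
  define H where "H = 4 * e + 1"
  have H: "0 < H" using e0 by (simp add: H_def)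
  define up where "up n = 2 * e * ln (real n) + H * ln (ln (real n))" for n :: nat
  define lo where "lo n = 2 * e * ln (real n) - H * ln (ln (real n))" for n :: nat
  define Q where "Q = W0 * C1 + W1 * C2"
  have Q: "0 < Q" using W C1 C2 by (simp add: Q_def add_pos_pos)
  have evB: "\<forall>\<^sub>F n in sequentially. up n + 1 \<le> B * ln (real n)"
    unfolding up_def B_def using e0 H by real_asymp
  have evlo: "\<forall>\<^sub>F n in sequentially. 0 \<le> lo n"
    unfolding lo_def using e0 H by real_asymp
  have evL: "\<forall>\<^sub>F n in sequentially. 1 \<le> ln (ln (real n))" by real_asymp
  have evU: "\<forall>\<^sub>F n in sequentially. W0 * C1 / (W1 * c2) < ln (real n) powr (1/2)" by real_asymp
  have evD: "\<forall>\<^sub>F n in sequentially. Q / (W0 * c1) < ln (real n) powr (1/2)" by real_asymp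
  have main: "\<forall>\<^sub>F n in sequentially. lo n < \<chi>_opt n \<and> \<chi>_opt n < up n + 1 \<and>
      c1 * exp (-1/2) * ln (real n) powr (- (3 * e + 1/2)) * real n powr (- e) \<le> \<alpha> n (\<chi>_opt n) \<and>
      \<alpha> n (\<chi>_opt n) \<le> (Q / W0) * ln (real n) powr (3 * e + 1/2) * real n powr (- e) \<and> 1 \<le> ln (ln (real n))"
    using ev1 ev2 ev3 ev4 evB evlo evL evU evD eventually_ge_at_top[of 1]
  proof eventually_elim
    case (elim n)
    define L where "L = ln (real n)"
    have L1: "1 \<le> L"
    proof (rule ccontr)
      assume "\<not> 1 \<le> L"
      moreover have "0 \<le> L" using elim(10) by (simp add: L_def)
      ultimately have "ln L \<le> 0" by (cases "L = 0") auto
      then show False using elim(7) by (simp add: L_def)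
    qed
    then have L0: "0 < L" by simp
    define N where "N = real n powr (- e)"
    have N0: "0 < N" using elim(10) by (simp add: N_def)
    have NL: "N = exp (- e * L)" using elim(10) by (simp add: N_def powr_def L_def)
    have exp_up: "exp (- up n / 2) = N * L powr (- (2 * e + 1/2))"
      unfolding NL powr_def using L0
      by (simp add: up_def H_def L_def exp_add[symmetric] field_simps)
    have exp_lo: "exp (- lo n / 2) = N * L powr (2 * e + 1/2)"
      unfolding NL powr_def using L0
      by (simp add: lo_def H_def L_def exp_add[symmetric] field_simps)
    have up_range: "0 \<le> up n" "up n + 1 \<le> B * L"
      using elim(5,7) e0 H L0 L1 by (auto simp: up_def L_def intro!: add_nonneg_nonneg mult_nonneg_nonneg)
    have lo_range: "0 \<le> lo n" "lo n \<le> B * L"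
    proof -
      have "0 \<le> H * ln (ln (real n))" using H elim(7) by (intro mult_nonneg_nonneg) auto
      then have "lo n \<le> up n" by (simp add: lo_def up_def)
      then show "lo n \<le> B * L" using up_range by linarith
    qed (rule elim(6))
    have \<alpha>_up: "\<alpha> n (up n) \<le> C1 * L powr (- e - 1/2) * N"
    proof -
      have "\<alpha> n (up n) \<le> C1 * L powr e * exp (- up n / 2)"
        using elim(2) up_range unfolding L_def by simp
      also have "\<dots> = C1 * (L powr e * L powr (- (2 * e + 1/2))) * N" unfolding exp_up by simp
      also have "L powr e * L powr (- (2 * e + 1/2)) = L powr (- e - 1/2)"
        unfolding powr_add[symmetric] by (simp add: algebra_simps)
      finally show ?thesis .
    qed
    have \<beta>_up: "\<beta> n (up n) \<le> C2 * L powr e * N"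
    proof -
      have "\<beta> n (up n) \<le> C2 * (L / real n) powr e"
        using elim(3) up_range unfolding L_def by simp
      also have "(L / real n) powr e = L powr e * N"
        using L0 elim(10) by (simp add: N_def powr_divide powr_minus divide_simps)
      finally show ?thesis by simp
    qed
    have risk_up: "R n (up n) \<le> Q * L powr e * N"
    proof -
      have "L powr (- e - 1/2) \<le> L powr e" using L1 e0 by (intro powr_mono) auto
      then have "C1 * L powr (- e - 1/2) * N \<le> C1 * L powr e * N"
        using C1 N0 by (intro mult_right_mono mult_left_mono) auto
      then have "W0 * \<alpha> n (up n) \<le> W0 * (C1 * L powr e * N)"
        using \<alpha>_up W by (intro mult_left_mono) auto
      moreover have "W1 * \<beta> n (up n) \<le> W1 * (C2 * L powr e * N)"
        using \<beta>_up W by (intro mult_left_mono) auto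
      ultimately show ?thesis unfolding R_def Q_def by (simp add: ring_distribs mult_ac)
    qed
    have risk_opt: "W0 * \<alpha> n (\<chi>_opt n) \<le> Q * L powr e * N"
    proof -
      have "W0 * \<alpha> n (\<chi>_opt n) \<le> R n (\<chi>_opt n)" unfolding R_def using W \<beta>_nonneg by simp
      then show ?thesis using opt[OF elim(10), of "up n"] risk_up by linarith
    qed
    \<comment> \<open>A level from \<open>up n + 1\<close> on would pay for a whole shell of additional Type II error, which is more
        than all the Type I error that is left at level \<open>up n\<close>.\<close>
    have below: "\<chi>_opt n < up n + 1"
    proof (rule ccontr)
      assume "\<not> ?thesis"
      then have ge: "up n + 1 \<le> \<chi>_opt n" by simp
      have shell: "c2 * (L powr (- e) * N) \<le> \<beta> n (up n + 1) - \<beta> n (up n)"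
      proof -
        have "c2 * (real n * L) powr (- e) \<le> \<beta> n (up n + 1) - \<beta> n (up n)"
          using elim(4) up_range unfolding L_def by simp
        then show ?thesis using L0 elim(10) by (simp add: powr_mult N_def mult_ac)
      qed
      have "W1 * \<beta> n (up n + 1) \<le> R n (\<chi>_opt n)"
        unfolding R_def using \<beta>_mono[OF ge] W \<alpha>_nonneg by (simp add: add_increasing)
      also have "\<dots> \<le> W0 * \<alpha> n (up n) + W1 * \<beta> n (up n)"
        using opt[OF elim(10), of "up n"] by (simp add: R_def)
      finally have "W1 * (\<beta> n (up n + 1) - \<beta> n (up n)) \<le> W0 * \<alpha> n (up n)"
        by (simp add: ring_distribs)
      moreover have "W1 * (c2 * (L powr (- e) * N)) \<le> W1 * (\<beta> n (up n + 1) - \<beta> n (up n))"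
        using shell W by (intro mult_left_mono) auto
      moreover have "W0 * \<alpha> n (up n) \<le> W0 * (C1 * L powr (- e - 1/2) * N)"
        using \<alpha>_up W by (intro mult_left_mono) auto
      ultimately have "W1 * (c2 * (L powr (- e) * N)) \<le> W0 * (C1 * L powr (- e - 1/2) * N)"
        by linarith
      moreover have "L powr (- e) = L powr (- e - 1/2) * L powr (1/2)"
        unfolding powr_add[symmetric] by simp
      ultimately have "(W1 * c2 * L powr (1/2)) * (L powr (- e - 1/2) * N)
          \<le> (W0 * C1) * (L powr (- e - 1/2) * N)"
        by (simp add: mult_ac)
      then have "W1 * c2 * L powr (1/2) \<le> W0 * C1"
        using N0 L0 by (subst (asm) mult_le_cancel_right) (auto simp: mult_less_0_iff zero_less_mult_iff)
      then have "L powr (1/2) \<le> W0 * C1 / (W1 * c2)" using W c2 by (simp add: field_simps)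
      then show False using elim(8) unfolding L_def by linarith
    qed
    \<comment> \<open>At \<open>lo n\<close> or below, the Type I error alone exceeds the risk at level \<open>up n\<close>.\<close>
    have above: "lo n < \<chi>_opt n"
    proof (rule ccontr)
      assume "\<not> ?thesis"
      then have le: "\<chi>_opt n \<le> lo n" by simp
      have "c1 * L powr (- e) * exp (- lo n / 2) \<le> \<alpha> n (lo n)"
        using elim(1) lo_range unfolding L_def by simp
      then have "c1 * (L powr (- e) * L powr (2 * e + 1/2)) * N \<le> \<alpha> n (\<chi>_opt n)"
        using \<alpha>_mono[OF le, of n] unfolding exp_lo by (simp add: mult_ac)
      also have "L powr (- e) * L powr (2 * e + 1/2) = L powr e * L powr (1/2)"
        unfolding powr_add[symmetric] by simp
      finally have "W0 * (c1 * (L powr e * L powr (1/2)) * N) \<le> W0 * \<alpha> n (\<chi>_opt n)"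
        using W by (intro mult_left_mono) auto
      then have "(W0 * c1 * L powr (1/2)) * (L powr e * N) \<le> Q * (L powr e * N)"
        using risk_opt by (simp add: mult_ac)
      then have "W0 * c1 * L powr (1/2) \<le> Q"
        using N0 L0 by (subst (asm) mult_le_cancel_right) (auto simp: mult_less_0_iff zero_less_mult_iff)
      then have "L powr (1/2) \<le> Q / (W0 * c1)" using W c1 by (simp add: field_simps)
      then show False using elim(9) unfolding L_def by linarith
    qed
    have lower: "c1 * exp (-1/2) * L powr (- (3 * e + 1/2)) * N \<le> \<alpha> n (\<chi>_opt n)"
    proof -
      have "exp (- (up n + 1) / 2) = exp (-1/2) * (N * L powr (- (2 * e + 1/2)))"
        unfolding exp_up[symmetric] exp_add[symmetric] by (simp add: field_simps)
      then have "c1 * exp (-1/2) * (L powr (- e) * L powr (- (2 * e + 1/2))) * N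
          = c1 * L powr (- e) * exp (- (up n + 1) / 2)"
        by simp
      also have "\<dots> \<le> \<alpha> n (up n + 1)" using elim(1)[rule_format, of "up n + 1"] up_range
        unfolding L_def by simp
      also have "\<dots> \<le> \<alpha> n (\<chi>_opt n)" using below by (intro \<alpha>_mono) simp
      also have "L powr (- e) * L powr (- (2 * e + 1/2)) = L powr (- (3 * e + 1/2))"
        unfolding powr_add[symmetric] by (simp add: algebra_simps)
      finally show ?thesis .
    qed
    have upper: "\<alpha> n (\<chi>_opt n) \<le> (Q / W0) * L powr (3 * e + 1/2) * N"
    proof -
      have "L powr e \<le> L powr (3 * e + 1/2)" using L1 e0 by (intro powr_mono) auto
      then have "Q * L powr e * N \<le> Q * L powr (3 * e + 1/2) * N"
        using Q N0 by (intro mult_right_mono mult_left_mono) auto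
      then have "W0 * \<alpha> n (\<chi>_opt n) \<le> Q * L powr (3 * e + 1/2) * N" using risk_opt by linarith
      then show ?thesis using W by (simp add: field_simps)
    qed
    show ?case using above below lower upper elim(7) unfolding L_def N_def by blast
  qed
  have bigo: "(\<lambda>n. \<chi>_opt n - (real k - 1) * ln (real n)) \<in> O(\<lambda>n. ln (ln (real n)))"
  proof (rule bigoI)
    show "\<forall>\<^sub>F n in sequentially. norm (\<chi>_opt n - (real k - 1) * ln (real n)) \<le> (H + 1) * norm (ln (ln (real n)))"
      using main
    proof eventually_elim
      case (elim n)
      have "2 * e = real k - 1" by (simp add: e_def)
      then have "\<bar>\<chi>_opt n - (real k - 1) * ln (real n)\<bar> \<le> H * ln (ln (real n)) + 1"
        using elim unfolding up_def lo_def by (auto simp: abs_le_iff)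
      also have "\<dots> \<le> (H + 1) * ln (ln (real n))" using elim by (simp add: ring_distribs)
      finally show ?case using elim by simp
    qed
  qed
  have polylog: "asymp_up_to_polylog (\<lambda>n. type1_prob k n p0 (\<chi>_opt n)) (\<lambda>n. real n powr (- (real k - 1) / 2))"
    unfolding asymp_up_to_polylog_def me
    using main W Q c1 unfolding \<alpha>_def
    by (intro exI[of _ "3 * e + 1/2"] exI[of _ "c1 * exp (-1/2)"] exI[of _ "Q / W0"])
       (auto elim!: eventually_mono)
  show ?thesis
    using dirichlet_ball_bounds[OF k p0 dirichlet_params] bigo polylog by blast
qed

end
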